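(* Let $K$ be a compact space. If $K$ admits local compensation, then $C(K)$ has the Bishop-Phelps-Bollobás (BPB) property for numerical radius.
   Context: All Banach spaces are real. A compact space is a compact Hausdorff topological space. $C(K)$ is the Banach space of continuous real-valued functions on $K$ with the supremum norm; its dual is identified with $\mathcal{M}(K)$, the space of regular Borel signed measures on $K$ with the total variation norm, and $B_{\mathcal{M}(K)}$ is its closed unit ball. $\omega^*$ denotes the weak$^*$ topology of $\mathcal{M}(K)=C(K)^*$. For $\mu\in\mathcal{M}(K)$, $\mu^+$ is its positive part. Compensation of a measure: $\nu\in\mathcal{M}(K)$ is a compensation of $\mu\in\mathcal{M}(K)$ if: $0\le\nu\le\mu^+$ and $\nu(K)=\mu(K)$ in case $\mu(K)>0$; and $\nu=0$ in case $\mu(K)\le 0$. $W(K)$ is the set of all $\omega^*$-continuous functions $F\colon K\to B_{\mathcal{M}(K)}$. $G\in W(K)$ is a compensation of $F\in W(K)$ if $G(t)$ is a compensation of $F(t)$ for every $t\in K$. $K$ admits local compensation if every element of $W(K)$ admits a compensation (in $W(K)$). For a Banach space $X$, $\mathfrak{L}(X)$ is the space of bounded linear operators $X\to X$, $\Pi(X)=\{(x,x^* )\in S_X\times S_{X^*}\colon x^*(x)=1\}$ (where $S$ denotes unit spheres), and the numerical radius of $T\in\mathfrak{L}(X)$ is $\nu(T)=\sup\{|x^*(T(x))|\colon (x,x^* )\in\Pi(X)\}$. $X$ has the BPB property for numerical radius if there is a function $\delta\colon(0,1)\to(0,1)$ such that: for every $0<\varepsilon<1$, every $T\in\mathfrak{L}(X)$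 with $\nu(T)=1$ and every $(x,x^* )\in\Pi(X)$ with $x^*(T(x))\ge 1-\delta(\varepsilon)$, there exist $T_0\in\mathfrak{L}(X)$ with $\nu(T_0)=1$ and $(x_0,x_0^* )\in\Pi(X)$ with $x_0^*(T_0(x_0))=1$ such that $\nu(T-T_0)\le\varepsilon$, $\|x-x_0\|\le\varepsilon$ and $\|x^*-x_0^*\|\le\varepsilon$. *)

theory Defs
  imports "HOL-Analysis.Analysis"
begin

text \<open>The compact space \<open>K\<close> is a type \<open>'k\<close> of class \<open>t2_space\<close> with \<open>compact UNIV\<close>, so \<open>C(K)\<close> is
  the type \<open>'k \<Rightarrow>\<^sub>C real\<close>: over a compact space every continuous function is bounded.\<close>

text \<open>The library shows completeness of \<open>bcontfun\<close> only over metric domains.\<close>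

instance bcontfun :: (topological_space, complete_space) complete_space
proof
  fix f :: "nat \<Rightarrow> 'a \<Rightarrow>\<^sub>C 'b"
  assume "Cauchy f"
  then have "uniformly_Cauchy_on UNIV (\<lambda>n. apply_bcontfun (f n))"
    unfolding uniformly_Cauchy_on_def Cauchy_def by (meson dist_fun_lt_imp_dist_val_lt)
  then obtain g where "uniform_limit UNIV (\<lambda>n. apply_bcontfun (f n)) g sequentially"
    using Cauchy_uniformly_convergent uniformly_convergent_on_def by blast
  then show "convergent f"
    by (metis uniform_limit_bcontfunE sequentially_bot convergentI)
qed

instance bcontfun :: (topological_space, banach) banach ..

text \<open>Signed measures are real-valued set functions, normalised to \<open>0\<close> outside the Borel sets so that
  equality of measures is equality of functions. Since they are real-valued their total variation
  is finite, so the real suprema and infima below are taken over bounded sets.\<close>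

definition signed_borel_measure :: "('k::topological_space set \<Rightarrow> real) \<Rightarrow> bool" where
  "signed_borel_measure \<mu> \<longleftrightarrow>
     \<mu> {} = 0 \<and>
     (\<forall>A::nat \<Rightarrow> 'k set. range A \<subseteq> sets borel \<and> disjoint_family A \<longrightarrow>
        (\<lambda>n. \<mu> (A n)) sums \<mu> (\<Union>n. A n)) \<and>
     (\<forall>A. A \<notin> sets borel \<longrightarrow> \<mu> A = 0)"

definition total_variation :: "('k::topological_space set \<Rightarrow> real) \<Rightarrow> 'k set \<Rightarrow> real" where
  "total_variation \<mu> A =
     Sup {(\<Sum>E\<in>P. \<bar>\<mu> E\<bar>) |P. finite P \<and> partition_on A P \<and> P \<subseteq> sets borel}"

definition regular_signed_measure :: "('k::topological_space set \<Rightarrow> real) \<Rightarrow> bool" where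
  "regular_signed_measure \<mu> \<longleftrightarrow>
     (\<forall>A\<in>sets borel.
        total_variation \<mu> A = (INF U\<in>{U. open U \<and> A \<subseteq> U}. total_variation \<mu> U) \<and>
        total_variation \<mu> A = (SUP C\<in>{C. compact C \<and> C \<subseteq> A}. total_variation \<mu> C))"

definition signed_measures :: "('k::topological_space set \<Rightarrow> real) set" where
  "signed_measures = {\<mu>. signed_borel_measure \<mu> \<and> regular_signed_measure \<mu>}"

definition signed_measures_ball :: "('k::topological_space set \<Rightarrow> real) set" where
  "signed_measures_ball = {\<mu> \<in> signed_measures. total_variation \<mu> UNIV \<le> 1}"

text \<open>Jordan decomposition.\<close>

definition pos_part :: "('k::topological_space set \<Rightarrow> real) \<Rightarrow> 'k set \<Rightarrow> real" where
  "pos_part \<mu> A = (total_variation \<mu> A + \<mu> A) / 2"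

definition neg_part :: "('k::topological_space set \<Rightarrow> real) \<Rightarrow> 'k set \<Rightarrow> real" where
  "neg_part \<mu> A = (total_variation \<mu> A - \<mu> A) / 2"

definition signed_integral ::
    "('k::topological_space set \<Rightarrow> real) \<Rightarrow> ('k \<Rightarrow> real) \<Rightarrow> real" where
  "signed_integral \<mu> f =
     (\<integral>x. f x \<partial>measure_of UNIV (sets borel) (\<lambda>A. ennreal (pos_part \<mu> A))) -
     (\<integral>x. f x \<partial>measure_of UNIV (sets borel) (\<lambda>A. ennreal (neg_part \<mu> A)))"

text \<open>The coarsest topology on the space of measures making every evaluation at an element of
  \<open>C(K)\<close> continuous.\<close>

definition weak_star_topology :: "('k::topological_space set \<Rightarrow> real) topology" where
  "weak_star_topology =
     pullback_topology signed_measures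
       (\<lambda>\<mu> (f :: 'k \<Rightarrow>\<^sub>C real). signed_integral \<mu> (apply_bcontfun f))
       (product_topology (\<lambda>_. euclideanreal) UNIV)"

definition is_compensation ::
    "('k::topological_space set \<Rightarrow> real) \<Rightarrow> ('k set \<Rightarrow> real) \<Rightarrow> bool" where
  "is_compensation \<nu> \<mu> \<longleftrightarrow>
     \<nu> \<in> signed_measures \<and>
     (if \<mu> UNIV > 0
      then (\<forall>A\<in>sets borel. 0 \<le> \<nu> A \<and> \<nu> A \<le> pos_part \<mu> A) \<and> \<nu> UNIV = \<mu> UNIV
      else \<nu> = (\<lambda>_. 0))"

definition weak_star_maps :: "('k::topological_space \<Rightarrow> 'k set \<Rightarrow> real) set" where
  "weak_star_maps =
     {F. continuous_map euclidean (subtopology weak_star_topology signed_measures_ball) F}"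

definition admits_local_compensation :: "'k::topological_space itself \<Rightarrow> bool" where
  "admits_local_compensation _ \<longleftrightarrow>
     (\<forall>F \<in> (weak_star_maps :: ('k \<Rightarrow> 'k set \<Rightarrow> real) set).
        \<exists>G \<in> weak_star_maps. \<forall>t. is_compensation (G t) (F t))"

definition state_pairs :: "('x::real_normed_vector \<times> ('x \<Rightarrow>\<^sub>L real)) set" where
  "state_pairs = {(x, x'). x \<in> sphere 0 1 \<and> x' \<in> sphere 0 1 \<and> blinfun_apply x' x = 1}"

definition numerical_radius :: "('x::real_normed_vector \<Rightarrow>\<^sub>L 'x) \<Rightarrow> real" where
  "numerical_radius T =
     (SUP (x, x')\<in>state_pairs. \<bar>blinfun_apply x' (blinfun_apply T x)\<bar>)"

definition BPB_numerical_radius :: "'x::banach itself \<Rightarrow> bool" where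
  "BPB_numerical_radius _ \<longleftrightarrow>
     (\<exists>\<delta>::real \<Rightarrow> real.
        (\<forall>\<epsilon>\<in>{0<..<1}. \<delta> \<epsilon> \<in> {0<..<1}) \<and>
        (\<forall>\<epsilon>\<in>{0<..<1}. \<forall>T :: 'x \<Rightarrow>\<^sub>L 'x. \<forall>(x, x')\<in>state_pairs.
           numerical_radius T = 1 \<and> blinfun_apply x' (blinfun_apply T x) \<ge> 1 - \<delta> \<epsilon> \<longrightarrow>
           (\<exists>T\<^sub>0 :: 'x \<Rightarrow>\<^sub>L 'x. \<exists>(x\<^sub>0, x\<^sub>0')\<in>state_pairs.
              numerical_radius T\<^sub>0 = 1 \<and>
              blinfun_apply x\<^sub>0' (blinfun_apply T\<^sub>0 x\<^sub>0) = 1 \<and>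
              numerical_radius (T - T\<^sub>0) \<le> \<epsilon> \<and>
              norm (x - x\<^sub>0) \<le> \<epsilon> \<and>
              norm (x' - x\<^sub>0') \<le> \<epsilon>)))"

end

theory Submission
  imports Defs
begin

text \<open>On \<open>C(K)\<close> the numerical radius is the norm. Let \<open>x\<close> and \<open>\<psi>\<close> be a state with \<open>\<psi> (T x)\<close> close to
  \<open>1\<close>. Write \<open>x = \<eta> q + (1 - \<eta>) x0\<close>, where \<open>x0\<close> is \<open>x / (1 - \<eta>)\<close> truncated to \<open>[-1, 1]\<close>; then
  \<open>x0 = sgn q\<close> where \<open>q\<close> does not vanish, and a functional of norm at most \<open>1\<close> that is almost \<open>1\<close> at
  \<open>x\<close> is almost \<open>1\<close> at \<open>q\<close>. Multiplying \<open>\<psi>\<close> by a weight supported where \<open>x \<cdot> T x\<close> is close to \<open>1\<close>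
  and normalising gives \<open>\<psi>0\<close>. At the points \<open>t\<close> of that support \<open>\<bar>T q t\<bar>\<close> is almost \<open>1\<close>, so the
  measure representing \<open>f \<mapsto> sgn (T q t) \<cdot> T (q f) t\<close> is almost positive and close to its compensation;
  \<open>x0\<close> times the compensation, normalised, represents at \<open>t\<close> an operator \<open>S\<close> near \<open>T\<close> with
  \<open>S x0 t = sgn (T q t)\<close>. Weak-star continuity of the compensation makes \<open>S f\<close> continuous.

  The hypothesis concerns measures and the rest of the argument functionals; the bridge is the Riesz
  representation theorem on a compact Hausdorff space. Of a compensation \<open>\<nu>\<close> of the measure of a
  functional \<open>\<phi>\<close> only \<open>0 \<le> \<nu> \<le> \<phi>\<^sup>+\<close> and \<open>\<nu>(K) = \<phi>(1)\<close> are used.\<close>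


text \<open>The new operator must attain its norm exactly, so state and operator have to move
  together. Giving \<open>q\<close> the small weight \<eta> in \<open>x\<close> serves both: as
  \<open>x0\<close> contributes at most \<open>1 - \<eta>\<close>, a deficit
  \<open>\<beta> * \<eta>\<close> at \<open>x\<close> leaves at most \<beta> at \<open>q\<close>;
  and inserting \<open>q\<close> kills the part of the measure where \<open>x0\<close> may fail to
  have modulus one.

  The obstacle is continuity in \<open>t\<close>: passing to the positive part of each measure would
  in general destroy weak-star continuity. A compensation keeps the total mass \<open>m\<close>, and
  this gives closeness, since a measure of norm at most one and mass \<open>m\<close> has a negative
  part of mass at most \<open>(1 - m) / 2\<close>.

  Points where \<open>T q\<close> is not near 1 or -1 are not corrected; they have to become
  invisible to the functional. Attainment at \<open>x\<close> makes
  \<open>f \<mapsto> \<psi> (f x)\<close> positive of mass one, so a Markov inequality bounds what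
  the localisation discards. The constant \<open>\<epsilon> ^ 3 / 48\<close> is the tolerance
  \<open>\<beta> * \<eta>\<close> times the admissible loss of mass
  \<open>\<epsilon> / 2\<close>.\<close>

lemma compact_t2_Urysohn:
  fixes S T :: "'k::t2_space set"
  assumes "compact (UNIV :: 'k set)" "closed S" "closed T" "S \<inter> T = {}"
  obtains f :: "'k \<Rightarrow> real" where "continuous_on UNIV f" "\<And>x. 0 \<le> f x" "\<And>x. f x \<le> 1"
    "\<And>x. x \<in> S \<Longrightarrow> f x = 0" "\<And>x. x \<in> T \<Longrightarrow> f x = 1"
proof -
  have "Hausdorff_space (euclidean :: 'k topology)"
    by (auto simp: Hausdorff_space_def disjnt_def separation_t2 intro: hausdorff)
  moreover have "compact_space (euclidean :: 'k topology)"
    using assms(1) by (simp add: compact_space_def)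
  ultimately have "normal_space (euclidean :: 'k topology)"
    using compact_Hausdorff_or_regular_imp_normal_space by blast
  then obtain f :: "'k \<Rightarrow> real"
    where f: "continuous_map euclidean (top_of_set {0..1}) f" "f ` S \<subseteq> {0}" "f ` T \<subseteq> {1}"
    using Urysohn_lemma[of euclidean S T 0 1] assms by (auto simp: disjnt_def)
  show ?thesis
  proof
    show "continuous_on UNIV f"
      using f(1) by (auto simp: continuous_map_in_subtopology)
    show "0 \<le> f x" "f x \<le> 1" for x
      using f(1) by (auto simp: continuous_map_in_subtopology Pi_iff)
  qed (use f in auto)
qed

lemma closed_real_levels:
  fixes f :: "'k::topological_space \<Rightarrow> real"
  assumes "continuous_on UNIV f"
  shows "closed {x. c \<le> f x}" "open {x. c < f x}"
  using assms by (auto intro!: closed_Collect_le open_Collect_less continuous_intros)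

section \<open>Riesz representation for positive functionals\<close>

text \<open>The axioms speak only of nonnegative continuous functions because the intended
  instances, the positive and negative parts of a functional, come from a supremum over minorants
  that is additive only there.\<close>

locale positive_functional =
  fixes \<Lambda> :: "('k::t2_space \<Rightarrow> real) \<Rightarrow> real"
  assumes compact: "compact (UNIV :: 'k set)"
    and add: "\<lbrakk>continuous_on UNIV f; continuous_on UNIV g; \<And>x. 0 \<le> f x; \<And>x. 0 \<le> g x\<rbrakk>
      \<Longrightarrow> \<Lambda> (\<lambda>x. f x + g x) = \<Lambda> f + \<Lambda> g"
    and scale: "\<lbrakk>continuous_on UNIV f; \<And>x. 0 \<le> f x; 0 \<le> a\<rbrakk> \<Longrightarrow> \<Lambda> (\<lambda>x. a * f x) = a * \<Lambda> f"
    and nonneg: "\<lbrakk>continuous_on UNIV f; \<And>x. 0 \<le> f x\<rbrakk> \<Longrightarrow> 0 \<le> \<Lambda> f"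
begin

lemma mono:
  assumes "continuous_on UNIV f" "continuous_on UNIV g" "\<And>x. 0 \<le> f x" "\<And>x. f x \<le> g x"
  shows "\<Lambda> f \<le> \<Lambda> g"
proof -
  have "\<Lambda> (\<lambda>x. f x + (g x - f x)) = \<Lambda> f + \<Lambda> (\<lambda>x. g x - f x)"
    using assms by (intro add continuous_intros) auto
  moreover have "0 \<le> \<Lambda> (\<lambda>x. g x - f x)"
    using assms by (intro nonneg continuous_intros) auto
  ultimately show ?thesis by simp
qed

lemma const: "0 \<le> a \<Longrightarrow> \<Lambda> (\<lambda>_. a) = a * \<Lambda> (\<lambda>_. 1)"
  using scale[of "\<lambda>_. 1" a] by simp

lemma one_nonneg: "0 \<le> \<Lambda> (\<lambda>_. 1)"
  by (rule nonneg) auto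

definition bumps :: "'k set \<Rightarrow> ('k \<Rightarrow> real) set" where
  "bumps U = {f. continuous_on UNIV f \<and> (\<forall>x. 0 \<le> f x \<and> f x \<le> 1) \<and> (\<forall>x. x \<notin> U \<longrightarrow> f x = 0)}"

definition content :: "'k set \<Rightarrow> ennreal" where
  "content U = (SUP f\<in>bumps U. ennreal (\<Lambda> f))"

definition outer :: "'k set \<Rightarrow> ennreal" where
  "outer A = (INF U\<in>{U. open U \<and> A \<subseteq> U}. content U)"

lemma bumpsD:
  assumes "f \<in> bumps U"
  shows "continuous_on UNIV f" "0 \<le> f x" "f x \<le> 1" "x \<notin> U \<Longrightarrow> f x = 0" "0 \<le> \<Lambda> f"
  using assms by (auto simp: bumps_def intro: nonneg)

lemma content_upper: "f \<in> bumps U \<Longrightarrow> ennreal (\<Lambda> f) \<le> content U"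
  unfolding content_def by (rule SUP_upper)

lemma content_mono: "U \<subseteq> V \<Longrightarrow> content U \<le> content V"
  unfolding content_def by (rule SUP_subset_mono) (auto simp: bumps_def)

lemma content_empty [simp]: "content {} = 0"
proof -
  have "\<Lambda> f = 0" if "f \<in> bumps {}" for f
  proof -
    have "f = (\<lambda>_. 0)" using that by (auto simp: bumps_def)
    then show ?thesis using const[of 0] by simp
  qed
  then show ?thesis
    unfolding content_def by (auto intro!: antisym SUP_least)
qed

lemma content_finite: "content U \<le> ennreal (\<Lambda> (\<lambda>_. 1))"
  unfolding content_def
  by (intro SUP_least ennreal_leI mono) (auto dest: bumpsD)

text \<open>Truncating at height \<open>e\<close> replaces the support condition of the usual proof:
  \<open>{x. e \<le> f x}\<close> is a compact subset of \<open>U\<close>.\<close>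

lemma le_by_truncation:
  assumes f: "continuous_on UNIV f" "\<And>x. 0 \<le> f x"
    and c: "\<And>e. 0 < e \<Longrightarrow> ennreal (\<Lambda> (\<lambda>x. max (f x - e) 0)) \<le> c"
  shows "ennreal (\<Lambda> f) \<le> c"
proof (rule ennreal_le_epsilon)
  fix e :: real assume e: "0 < e"
  \<comment> \<open>Truncation at height \<open>d\<close> costs at most
    \<open>d * \<Lambda> 1\<close>; the \<open>+ 1\<close> covers the case of total mass
    zero.\<close>
  define d where "d = e / (\<Lambda> (\<lambda>_. 1) + 1)"
  have d: "0 < d" "d * \<Lambda> (\<lambda>_. 1) \<le> e"
    using e one_nonneg by (auto simp: d_def field_simps add_pos_nonneg)
  have "\<Lambda> f \<le> \<Lambda> (\<lambda>x. max (f x - d) 0 + d)"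
    using f d by (intro mono continuous_intros) auto
  also have "\<dots> = \<Lambda> (\<lambda>x. max (f x - d) 0) + d * \<Lambda> (\<lambda>_. 1)"
    using f d const[of d] by (subst add) (auto intro!: continuous_intros)
  finally have "ennreal (\<Lambda> f) \<le> ennreal (\<Lambda> (\<lambda>x. max (f x - d) 0) + e)"
    using d by (intro ennreal_leI) auto
  also have "\<dots> = ennreal (\<Lambda> (\<lambda>x. max (f x - d) 0)) + ennreal e"
    using e f by (intro ennreal_plus nonneg continuous_intros) auto
  also have "\<dots> \<le> c + ennreal e"
    using c[OF d(1)] by (intro add_right_mono)
  finally show "ennreal (\<Lambda> f) \<le> c + ennreal e" .
qed

text \<open>The part of \<open>f\<close> above height \<open>e\<close> sits on a closed set
  \<open>L\<close> covered by \<open>U\<close> and \<open>V\<close>. Since \<open>L - U\<close> and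
  \<open>L - V\<close> are disjoint and closed, a Urysohn function that is 0 on the first and 1 on
  the second splits the truncation into a bump for \<open>U\<close> and a bump for
  \<open>V\<close>.\<close>

lemma content_Un:
  assumes "open U" "open V"
  shows "content (U \<union> V) \<le> content U + content V"
  unfolding content_def[of "U \<union> V"]
proof (rule SUP_least, rule le_by_truncation)
  fix f and e :: real assume f: "f \<in> bumps (U \<union> V)" and e: "0 < e"
  note f' = bumpsD[OF f]
  define L where "L = {x. e \<le> f x}"
  have L: "closed L" unfolding L_def by (rule closed_real_levels) (rule f')
  have "L \<subseteq> U \<union> V" using f'(4) e unfolding L_def by force
  then have disj: "(L - U) \<inter> (L - V) = {}" by auto
  obtain h where h: "continuous_on UNIV h" "\<And>x. 0 \<le> h x" "\<And>x. h x \<le> 1"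
    "\<And>x. x \<in> L - U \<Longrightarrow> h x = 0" "\<And>x. x \<in> L - V \<Longrightarrow> h x = (1::real)"
    using compact_t2_Urysohn[OF compact _ _ disj] L assms by (auto simp: closed_Diff)
  let ?f = "\<lambda>x. max (f x - e) 0"
  have z: "?f x = 0" if "x \<notin> L" for x using that by (auto simp: L_def)
  have cont: "continuous_on UNIV ?f" by (intro continuous_intros f')
  have b: "0 \<le> ?f x" "?f x \<le> 1" for x using f'(2,3)[of x] e by auto
  have 1: "(\<lambda>x. ?f x * h x) \<in> bumps U"
    unfolding bumps_def mem_Collect_eq
  proof (intro conjI allI impI)
    show "continuous_on UNIV (\<lambda>x. ?f x * h x)" by (intro continuous_intros cont h)
    show "0 \<le> ?f x * h x" for x using b h by simp
    show "?f x * h x \<le> 1" for x using b h by (intro mult_le_one) auto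
    show "?f x * h x = 0" if "x \<notin> U" for x using that z[of x] h(4)[of x] by (cases "x \<in> L") auto
  qed
  have 2: "(\<lambda>x. ?f x * (1 - h x)) \<in> bumps V"
    unfolding bumps_def mem_Collect_eq
  proof (intro conjI allI impI)
    show "continuous_on UNIV (\<lambda>x. ?f x * (1 - h x))" by (intro continuous_intros cont h)
    show "0 \<le> ?f x * (1 - h x)" for x using b h by simp
    show "?f x * (1 - h x) \<le> 1" for x using b[of x] h(2,3)[of x] by (intro mult_le_one) auto
    show "?f x * (1 - h x) = 0" if "x \<notin> V" for x using that z[of x] h(5)[of x] by (cases "x \<in> L") auto
  qed
  have "\<Lambda> ?f = \<Lambda> (\<lambda>x. ?f x * h x + ?f x * (1 - h x))" by (simp add: algebra_simps)
  also have "\<dots> = \<Lambda> (\<lambda>x. ?f x * h x) + \<Lambda> (\<lambda>x. ?f x * (1 - h x))"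
    using bumpsD[OF 1] bumpsD[OF 2] by (intro add) auto
  finally have "ennreal (\<Lambda> ?f) = ennreal (\<Lambda> (\<lambda>x. ?f x * h x)) + ennreal (\<Lambda> (\<lambda>x. ?f x * (1 - h x)))"
    using bumpsD[OF 1] bumpsD[OF 2] by simp
  also have "\<dots> \<le> content U + content V"
    by (intro add_mono content_upper 1 2)
  finally show "ennreal (\<Lambda> ?f) \<le> content U + content V" .
qed (auto dest: bumpsD)

lemma content_UN_finite:
  assumes "\<And>i::nat. open (U i)"
  shows "content (\<Union>i<n. U i) \<le> (\<Sum>i<n. content (U i))"
proof (induction n)
  case (Suc n)
  have "content (\<Union>i<Suc n. U i) = content ((\<Union>i<n. U i) \<union> U n)"
    by (simp add: lessThan_Suc Un_commute)
  also have "\<dots> \<le> content (\<Union>i<n. U i) + content (U n)"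
    using assms by (intro content_Un) auto
  also have "\<dots> \<le> (\<Sum>i<Suc n. content (U i))"
    using Suc.IH by (simp add: add_right_mono)
  finally show ?case .
qed simp

text \<open>After truncation the function lives on a compact set, which finitely many of the
  \<open>U i\<close> cover; this reduces the claim to the finite case.\<close>

lemma content_UN:
  assumes U: "\<And>i::nat. open (U i)"
  shows "content (\<Union>i. U i) \<le> (\<Sum>i. content (U i))"
  unfolding content_def[of "\<Union>i. U i"]
proof (rule SUP_least, rule le_by_truncation)
  fix f and e :: real assume f: "f \<in> bumps (\<Union>i. U i)" and e: "0 < e"
  note f' = bumpsD[OF f]
  define L where "L = {x. e \<le> f x}"
  have "closed L" unfolding L_def by (rule closed_real_levels) (rule f')
  then have "compact L" using compact compact_Int_closed[of UNIV L] by simp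
  moreover have "L \<subseteq> (\<Union>i. U i)" using f'(4) e unfolding L_def by force
  ultimately obtain D where D: "finite D" "L \<subseteq> (\<Union>i\<in>D. U i)"
    using compactE_image[of L UNIV U] U by (metis subset_UNIV)
  obtain n where "D \<subseteq> {..<n}" using D(1) finite_nat_iff_bounded by auto
  with D have L: "L \<subseteq> (\<Union>i<n. U i)" by blast
  have "(\<lambda>x. max (f x - e) 0) \<in> bumps (\<Union>i<n. U i)"
    unfolding bumps_def mem_Collect_eq
  proof (intro conjI allI impI)
    show "max (f x - e) 0 = 0" if "x \<notin> (\<Union>i<n. U i)" for x
    proof -
      have "x \<notin> L" using that L by blast
      then show ?thesis by (simp add: L_def)
    qed
    show "max (f x - e) 0 \<le> 1" for x using f'(3)[of x] e by auto
  qed (auto intro!: continuous_intros f')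
  then have "ennreal (\<Lambda> (\<lambda>x. max (f x - e) 0)) \<le> content (\<Union>i<n. U i)"
    by (rule content_upper)
  also have "\<dots> \<le> (\<Sum>i<n. content (U i))" by (rule content_UN_finite) (rule U)
  also have "\<dots> \<le> (\<Sum>i. content (U i))" by (rule sum_le_suminf) auto
  finally show "ennreal (\<Lambda> (\<lambda>x. max (f x - e) 0)) \<le> (\<Sum>i. content (U i))" .
qed (auto dest: bumpsD)

lemma outer_open: "open U \<Longrightarrow> outer U = content U"
  unfolding outer_def by (intro antisym INF_greatest INF_lower) (auto intro: content_mono)

lemma outer_approx:
  assumes "0 < e"
  obtains U where "open U" "A \<subseteq> U" "content U \<le> outer A + ennreal e"
proof -
  have "outer A \<le> content UNIV" unfolding outer_def by (rule INF_lower) auto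
  then have "outer A \<noteq> top"
    using content_finite[of UNIV] by (metis ennreal_neq_top neq_top_trans)
  then have "outer A < outer A + ennreal e"
    using assms by (cases "outer A") (auto simp: ennreal_less_iff simp flip: ennreal_plus)
  then obtain U where "open U" "A \<subseteq> U" "content U < outer A + ennreal e"
    unfolding outer_def INF_less_iff by auto
  then show ?thesis by (auto intro: that)
qed

lemma outer_measure_space_outer: "outer_measure_space (Pow UNIV) outer"
  unfolding outer_measure_space_def
proof (intro conjI)
  show "positive (Pow UNIV) outer"
    by (simp add: positive_def outer_open)
  show "increasing (Pow UNIV) outer"
    unfolding increasing_def outer_def by (auto intro!: INF_superset_mono)
  show "countably_subadditive (Pow UNIV) outer"
    unfolding countably_subadditive_def
  proof (intro allI impI)
    fix A :: "nat \<Rightarrow> 'k set"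
    show "outer (\<Union>i. A i) \<le> (\<Sum>i. outer (A i))"
    proof (rule ennreal_le_epsilon)
      fix e :: real assume e: "0 < e"
      have "\<exists>U. open U \<and> A i \<subseteq> U \<and> content U \<le> outer (A i) + ennreal (e * (1/2) ^ Suc i)" for i
        by (rule outer_approx[of "e * (1/2) ^ Suc i" "A i"]) (use e in auto)
      then obtain U where U: "\<And>i. open (U i)" "\<And>i. A i \<subseteq> U i"
        "\<And>i. content (U i) \<le> outer (A i) + ennreal (e * (1/2) ^ Suc i)" by metis
      have "outer (\<Union>i. A i) \<le> content (\<Union>i. U i)"
        unfolding outer_def using U(1,2) by (intro INF_lower) fastforce
      also have "\<dots> \<le> (\<Sum>i. content (U i))" by (rule content_UN) (rule U)
      also have "\<dots> \<le> (\<Sum>i. outer (A i) + ennreal (e * (1/2) ^ Suc i))"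
        by (intro suminf_le U) auto
      also have "\<dots> = (\<Sum>i. outer (A i)) + (\<Sum>i. ennreal (e * (1/2) ^ Suc i))"
        by (rule suminf_add[symmetric]) auto
      also have "(\<Sum>i. ennreal (e * (1/2) ^ Suc i)) = ennreal e"
        using sums_mult[OF power_half_series, of e] e
        by (intro suminf_ennreal_eq) auto
      finally show "outer (\<Union>i. A i) \<le> (\<Sum>i. outer (A i)) + ennreal e" .
    qed
  qed
qed

text \<open>This is the half of the Caratheodory condition that subadditivity does not give. Take an
  open \<open>V\<close> containing \<open>A\<close> that is almost optimal. A truncated bump for
  \<open>V \<inter> U\<close> lives on a closed \<open>L\<close>, and adding to it a bump for
  \<open>V - L\<close>, an open set containing \<open>A - U\<close>, neither exceeds 1 nor leaves
  \<open>V\<close>.\<close>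

lemma outer_add_le:
  assumes U: "open U"
  shows "outer (A \<inter> U) + outer (A - U) \<le> outer A"
proof (rule ennreal_le_epsilon)
  fix e :: real assume e: "0 < e"
  obtain V where V: "open V" "A \<subseteq> V" "content V \<le> outer A + ennreal e"
    using outer_approx[OF e] by blast
  have main: "ennreal (\<Lambda> f) + outer (A - U) \<le> content V"
    if f: "f \<in> bumps (V \<inter> U)" for f
  proof -
    note f' = bumpsD[OF f]
    have trunc: "ennreal (\<Lambda> (\<lambda>x. max (f x - d) 0)) + outer (A - U) \<le> content V" if d: "0 < d" for d
    proof -
      define L where "L = {x. d \<le> f x}"
      let ?f = "\<lambda>x. max (f x - d) 0"
      have L: "closed L" unfolding L_def by (rule closed_real_levels) (rule f')
      have LU: "L \<subseteq> V \<inter> U" using f'(4) d unfolding L_def by force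
      have "outer (A - U) \<le> content (V - L)"
        unfolding outer_def using V L LU by (intro INF_lower) (auto simp: open_Diff)
      moreover have "ennreal (\<Lambda> ?f) + content (V - L) \<le> content V"
      proof -
        have "ennreal (\<Lambda> ?f) + content (V - L) = (SUP g\<in>bumps (V - L). ennreal (\<Lambda> ?f) + ennreal (\<Lambda> g))"
          unfolding content_def
          by (rule ennreal_SUP_add_right) (auto simp: bumps_def intro!: exI[of _ "\<lambda>_. 0"])
        also have "\<dots> \<le> content V"
        proof (rule SUP_least)
          fix g assume g: "g \<in> bumps (V - L)"
          note g' = bumpsD[OF g]
          have c: "continuous_on UNIV ?f" by (intro continuous_intros f')
          have "(\<lambda>x. ?f x + g x) \<in> bumps V"
            unfolding bumps_def mem_Collect_eq
          proof (intro conjI allI impI)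
            show "continuous_on UNIV (\<lambda>x. ?f x + g x)" by (intro continuous_intros f' g')
            show "0 \<le> ?f x + g x" for x using g'(2)[of x] by simp
            show "?f x + g x \<le> 1" for x
              using g'(3)[of x] g'(4)[of x] f'(3)[of x] d by (cases "x \<in> L") (auto simp: L_def)
            show "?f x + g x = 0" if "x \<notin> V" for x
              using g'(4)[of x] f'(4)[of x] that d by auto
          qed
          then have "ennreal (\<Lambda> (\<lambda>x. ?f x + g x)) \<le> content V" by (rule content_upper)
          also have "\<Lambda> (\<lambda>x. ?f x + g x) = \<Lambda> ?f + \<Lambda> g"
            by (intro add c g') auto
          finally show "ennreal (\<Lambda> ?f) + ennreal (\<Lambda> g) \<le> content V"
            using nonneg[OF c] g'(5) by (simp add: ennreal_plus)
        qed
        finally show ?thesis .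
      qed
      ultimately show ?thesis by (meson add_left_mono order_trans)
    qed
    \<comment> \<open>The bound without the bump term is wanted on its own: it licenses the
      cancellation of the \<open>ennreal\<close> subtraction below.\<close>
    have "outer (A - U) \<le> ennreal (\<Lambda> (\<lambda>x. max (f x - 1) 0)) + outer (A - U)" by simp
    also have "\<dots> \<le> content V" by (rule trunc) simp
    finally have le: "outer (A - U) \<le> content V" .
    have "ennreal (\<Lambda> f) \<le> content V - outer (A - U)"
      by (rule le_by_truncation[OF f'(1,2)]) (use trunc in \<open>auto simp: ennreal_le_minus_iff\<close>)
    then have "ennreal (\<Lambda> f) + outer (A - U) \<le> content V - outer (A - U) + outer (A - U)"
      by (rule add_right_mono)
    then show ?thesis using diff_add_cancel_ennreal[OF le] by simp
  qed
  have "outer (A \<inter> U) \<le> content (V \<inter> U)"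
    unfolding outer_def using V U by (intro INF_lower) auto
  then have "outer (A \<inter> U) + outer (A - U) \<le> content (V \<inter> U) + outer (A - U)"
    by (rule add_right_mono)
  also have "\<dots> = (SUP f\<in>bumps (V \<inter> U). ennreal (\<Lambda> f) + outer (A - U))"
    unfolding content_def
    by (rule ennreal_SUP_add_left[symmetric]) (auto simp: bumps_def intro!: exI[of _ "\<lambda>_. 0"])
  also have "\<dots> \<le> content V" by (intro SUP_least main)
  also note V(3)
  finally show "outer (A \<inter> U) + outer (A - U) \<le> outer A + ennreal e" .
qed

end


section \<open>Continuous functions and finite Borel measures on a compact space\<close>

lemma continuous_bounded_compact:
  fixes f :: "'k::topological_space \<Rightarrow> real"
  assumes "compact (UNIV :: 'k set)" "continuous_on UNIV f"
  obtains c where "0 < c" "\<And>x. \<bar>f x\<bar> \<le> c"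
proof -
  have "bounded (range f)"
    using assms compact_continuous_image compact_imp_bounded by blast
  then show ?thesis
    using that unfolding bounded_pos by (auto simp: real_norm_def)
qed

lemma finite_measure_continuous_integrable:
  fixes f :: "'k::topological_space \<Rightarrow> real"
  assumes "compact (UNIV :: 'k set)" "continuous_on UNIV f" "finite_measure M" "sets M = sets borel"
  shows "integrable M f"
proof -
  obtain c where c: "\<And>x. \<bar>f x\<bar> \<le> c"
    using continuous_bounded_compact[OF assms(1,2)] by blast
  have "f \<in> borel_measurable M"
    using borel_measurable_continuous_onI[OF assms(2)] measurable_cong_sets[OF assms(4) refl] by blast
  then show ?thesis
    using c by (intro finite_measure.integrable_const_bound[OF assms(3), where B = c]) auto
qed

text \<open>Only the indices below the ceiling of \<open>n * y\<close> contribute, and rounding up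
  costs one step of height \<open>1 / n\<close>. This controls the staircase built from the level
  sets of a function.\<close>

lemma sum_level_indicators_le:
  fixes y :: real
  assumes "0 \<le> y" "0 < n"
  shows "(\<Sum>i<n. (1 / real n) * of_bool (real i / real n < y)) \<le> y + 1 / real n"
proof -
  have sub: "{i. i < n \<and> real i / real n < y} \<subseteq> {..<nat \<lceil>real n * y\<rceil>}"
  proof
    fix i assume "i \<in> {i. i < n \<and> real i / real n < y}"
    then have "real i < real n * y" using assms by (simp add: field_simps)
    then show "i \<in> {..<nat \<lceil>real n * y\<rceil>}" by (simp add: less_ceiling_iff zless_nat_eq_int_zless)
  qed
  have "(\<Sum>i<n. of_bool (real i / real n < y) :: real) = real (card {i. i < n \<and> real i / real n < y})"
    by (simp add: sum.If_cases of_bool_def lessThan_def Collect_conj_eq)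
  also have "\<dots> \<le> real (nat \<lceil>real n * y\<rceil>)"
    using card_mono[OF _ sub] by simp
  also have "\<dots> \<le> real n * y + 1" using assms by simp
  finally have "(1 / real n) * (\<Sum>i<n. of_bool (real i / real n < y) :: real) \<le> (1 / real n) * (real n * y + 1)"
    by (intro mult_left_mono) auto
  then show ?thesis using assms by (simp add: sum_distrib_left field_simps)
qed

section \<open>The Riesz measure and its integrals\<close>

context positive_functional
begin

definition riesz_measure :: "'k measure" where
  "riesz_measure = measure_of UNIV (sets borel) outer"

lemma sets_riesz_measure [simp]: "sets riesz_measure = sets borel"
  and space_riesz_measure [simp]: "space riesz_measure = UNIV"
  unfolding riesz_measure_def
  by (metis sets.sets_measure_of_eq space_borel) (simp add: space_measure_of_conv)

text \<open>\<open>measure_of\<close> returns the given set function only if that function is a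
  measure. By \<open>outer_add_le\<close> the open sets satisfy Caratheodory's condition, so the
  lambda system, a sigma algebra on which \<open>outer\<close> is a measure, contains the Borel
  sets.\<close>

lemma emeasure_riesz_measure:
  assumes "A \<in> sets borel"
  shows "emeasure riesz_measure A = outer A"
proof -
  let ?L = "lambda_system UNIV (Pow UNIV) outer"
  have ms: "measure_space UNIV ?L outer"
    by (rule sigma_algebra.caratheodory_lemma[OF sigma_algebra_Pow outer_measure_space_outer])
  interpret Pw: sigma_algebra UNIV "Pow (UNIV :: 'k set)" by (rule sigma_algebra_Pow)
  have op: "U \<in> ?L" if "open U" for U
    unfolding Pw.lambda_system_eq
  proof (clarsimp)
    fix A
    have sa: "subadditive (Pow UNIV) outer"
      using outer_measure_space_outer Pw.countably_subadditive_subadditive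
      unfolding outer_measure_space_def by blast
    have "outer ((A \<inter> U) \<union> (A - U)) \<le> outer (A \<inter> U) + outer (A - U)"
      by (rule subadditiveD[OF sa]) auto
    then have "outer A \<le> outer (A \<inter> U) + outer (A - U)"
      by (simp add: Int_Diff_Un)
    with outer_add_le[OF that] show "outer (A \<inter> U) + outer (A - U) = outer A"
      by (rule antisym)
  qed
  have sL: "sigma_algebra UNIV ?L" using ms by (simp add: measure_space_def)
  have "sets borel \<subseteq> ?L"
    unfolding borel_def using sigma_algebra.sigma_sets_subset[OF sL, of "{S. open S}"] op by auto
  then have "measure_space UNIV (sets borel) outer"
    using measure_down[OF ms] sets.sigma_algebra_axioms[of borel] by simp
  then show ?thesis
    unfolding riesz_measure_def measure_space_def
    using assms by (intro emeasure_measure_of_sigma) auto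
qed

lemma emeasure_riesz_UNIV: "emeasure riesz_measure UNIV = ennreal (\<Lambda> (\<lambda>_. 1))"
proof -
  have "content UNIV = ennreal (\<Lambda> (\<lambda>_. 1))"
    by (intro antisym content_finite content_upper) (auto simp: bumps_def)
  then show ?thesis by (simp add: emeasure_riesz_measure outer_open)
qed

sublocale riesz: finite_measure riesz_measure
  by (rule finite_measureI) (simp add: emeasure_riesz_UNIV)

lemma measure_riesz_UNIV: "measure riesz_measure UNIV = \<Lambda> (\<lambda>_. 1)"
  using emeasure_riesz_UNIV one_nonneg by (simp add: measure_def)

lemma bump_le_measure:
  assumes "f \<in> bumps U" "open U"
  shows "\<Lambda> f \<le> measure riesz_measure U"
proof -
  have "ennreal (\<Lambda> f) \<le> emeasure riesz_measure U"
    using content_upper[OF assms(1)] assms(2) by (simp add: emeasure_riesz_measure outer_open)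
  then show ?thesis by (simp add: riesz.emeasure_eq_measure)
qed

lemma riesz_outer_regular:
  assumes "A \<in> sets borel" "0 < e"
  obtains U where "open U" "A \<subseteq> U" "measure riesz_measure (U - A) \<le> e"
proof -
  obtain U where U: "open U" "A \<subseteq> U" "content U \<le> outer A + ennreal e"
    using outer_approx[OF assms(2)] by blast
  then have "emeasure riesz_measure U \<le> emeasure riesz_measure A + ennreal e"
    using assms by (simp add: emeasure_riesz_measure outer_open)
  then have "measure riesz_measure U \<le> measure riesz_measure A + e"
    using assms by (simp add: riesz.emeasure_eq_measure flip: ennreal_plus)
  moreover have "measure riesz_measure (U - A) = measure riesz_measure U - measure riesz_measure A"
    using U assms by (intro riesz.finite_measure_Diff) auto
  ultimately show ?thesis using that U by simp
qed

lemma integrable_riesz: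
  "continuous_on UNIV f \<Longrightarrow> integrable riesz_measure (f :: 'k \<Rightarrow> real)"
  using finite_measure_continuous_integrable[OF compact _ riesz.finite_measure_axioms] by simp

text \<open>Slice \<open>f\<close> into \<open>n\<close> layers of height \<open>1 / n\<close>. A
  layer multiplied by \<open>n\<close> is a bump for the level set above which it starts, so its
  value is at most the measure of that set; the staircase formed by these sets exceeds
  \<open>f\<close> by at most \<open>1 / n\<close>.\<close>

lemma le_integral_riesz_unit:
  assumes f: "continuous_on UNIV f" "\<And>x. 0 \<le> f x" "\<And>x. f x \<le> 1"
  shows "\<Lambda> f \<le> (\<integral>x. f x \<partial>riesz_measure)"
proof (rule field_le_epsilon)
  fix e :: real assume e: "0 < e"
  let ?m = "\<Lambda> (\<lambda>_. 1)"
  \<comment> \<open>Chosen so that the total staircase error \<open>?m / n\<close> is at most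
    \<open>e\<close>.\<close>
  obtain n where n: "?m / e < real n" using reals_Archimedean2 by blast
  then have n0: "0 < n"
    using one_nonneg e by (metis divide_nonneg_pos gr0I not_less of_nat_0)
  define g where "g i x = min (f x) (real (Suc i) / real n) - min (f x) (real i / real n)" for i x
  have contg: "continuous_on UNIV (g i)" for i
    unfolding g_def by (intro continuous_intros f)
  have g0: "0 \<le> g i x" for i x
    unfolding g_def using n0 by (auto simp: min_def field_simps)
  have gb: "(\<lambda>x. real n * g i x) \<in> bumps {x. real i / real n < f x}" for i
    unfolding bumps_def mem_Collect_eq
  proof (intro conjI allI impI)
    show "continuous_on UNIV (\<lambda>x. real n * g i x)" by (intro continuous_intros contg)
    show "0 \<le> real n * g i x" for x using g0 by simp
    show "real n * g i x \<le> 1" for x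
      using n0 unfolding g_def by (auto simp: min_def field_simps)
    show "real n * g i x = 0" if "\<not> real i / real n < f x" for x
    proof -
      have "real i / real n \<le> real (Suc i) / real n" by (simp add: divide_right_mono)
      with that show ?thesis unfolding g_def by (simp add: min_def)
    qed
  qed
  have "real n * \<Lambda> (g i) \<le> measure riesz_measure {x. real i / real n < f x}" for i
    using bump_le_measure[OF gb] closed_real_levels(2)[OF f(1)] scale[OF contg g0, of "real n"] by simp
  then have gm: "\<Lambda> (g i) \<le> (1 / real n) * measure riesz_measure {x. real i / real n < f x}" for i
    using n0 by (simp add: field_simps)
  have tele: "\<Lambda> (\<lambda>x. min (f x) (real k / real n)) = (\<Sum>i<k. \<Lambda> (g i))" for k
  proof (induction k)
    case 0
    have "(\<lambda>x. min (f x) (real 0 / real n)) = (\<lambda>_. 0)" by (intro ext) (simp add: f)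
    then show ?case using const[of 0] by simp
  next
    case (Suc k)
    have "\<Lambda> (\<lambda>x. min (f x) (real (Suc k) / real n)) = \<Lambda> (\<lambda>x. min (f x) (real k / real n) + g k x)"
      by (simp add: g_def)
    also have "\<dots> = \<Lambda> (\<lambda>x. min (f x) (real k / real n)) + \<Lambda> (g k)"
      using f by (intro add contg g0 continuous_intros) auto
    finally show ?case using Suc.IH by simp
  qed
  have lev: "{x. real i / real n < f x} \<in> sets riesz_measure" for i
    using closed_real_levels(2)[OF f(1)] by auto
  have intl: "integrable riesz_measure (\<lambda>x. (1 / real n) * indicator {x. real i / real n < f x} x)" for i
    using lev[of i] by (simp add: riesz.emeasure_eq_measure)
  have "\<Lambda> f = (\<Sum>i<n. \<Lambda> (g i))"
    using tele[of n] f(3) n0 by (simp add: min_absorb1)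
  also have "\<dots> \<le> (\<Sum>i<n. (1 / real n) * measure riesz_measure {x. real i / real n < f x})"
    by (rule sum_mono) (rule gm)
  also have "\<dots> = (\<Sum>i<n. \<integral>x. (1 / real n) * indicator {x. real i / real n < f x} x \<partial>riesz_measure)"
    using lev by simp
  also have "\<dots> = (\<integral>x. (\<Sum>i<n. (1 / real n) * indicator {x. real i / real n < f x} x) \<partial>riesz_measure)"
    by (rule Bochner_Integration.integral_sum[symmetric]) (rule intl)
  also have "\<dots> \<le> (\<integral>x. f x + 1 / real n \<partial>riesz_measure)"
    using sum_level_indicators_le[OF f(2) n0]
    by (intro integral_mono Bochner_Integration.integrable_sum intl integrable_riesz continuous_intros f)
      (simp add: indicator_def)
  also have "\<dots> = (\<integral>x. f x \<partial>riesz_measure) + ?m / real n"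
    using integrable_riesz[OF f(1)] by (simp add: measure_riesz_UNIV)
  also have "?m / real n \<le> e"
    using n n0 e by (simp add: field_simps)
  finally show "\<Lambda> f \<le> (\<integral>x. f x \<partial>riesz_measure) + e" by simp
qed

text \<open>The missing inequality is the known one applied to \<open>1 - f\<close>, because both
  sides give the same value to the constant 1.\<close>

lemma integral_riesz_unit:
  assumes f: "continuous_on UNIV f" "\<And>x. 0 \<le> f x" "\<And>x. f x \<le> 1"
  shows "(\<integral>x. f x \<partial>riesz_measure) = \<Lambda> f"
proof (rule antisym)
  have "\<Lambda> (\<lambda>x. 1 - f x) \<le> (\<integral>x. 1 - f x \<partial>riesz_measure)"
    using f by (intro le_integral_riesz_unit continuous_intros) auto
  also have "\<dots> = \<Lambda> (\<lambda>_. 1) - (\<integral>x. f x \<partial>riesz_measure)"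
    using integrable_riesz[OF f(1)] by (simp add: measure_riesz_UNIV)
  finally have "\<Lambda> (\<lambda>x. 1 - f x) \<le> \<Lambda> (\<lambda>_. 1) - (\<integral>x. f x \<partial>riesz_measure)" .
  moreover have "\<Lambda> (\<lambda>x. f x + (1 - f x)) = \<Lambda> f + \<Lambda> (\<lambda>x. 1 - f x)"
    using f by (intro add continuous_intros) auto
  ultimately show "(\<integral>x. f x \<partial>riesz_measure) \<le> \<Lambda> f" by simp
qed (rule le_integral_riesz_unit[OF f])

theorem integral_riesz:
  assumes f: "continuous_on UNIV f" "\<And>x. 0 \<le> f x"
  shows "(\<integral>x. f x \<partial>riesz_measure) = \<Lambda> f"
proof -
  obtain c where c: "0 < c" "\<And>x. \<bar>f x\<bar> \<le> c"
    using continuous_bounded_compact[OF compact f(1)] by blast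
  have cont: "continuous_on UNIV (\<lambda>x. f x / c)" using c by (intro continuous_intros f) auto
  have "f x / c \<le> 1" for x using c(1) c(2)[of x] by (simp add: abs_le_iff)
  then have "(\<integral>x. f x / c \<partial>riesz_measure) = \<Lambda> (\<lambda>x. f x / c)"
    using c f by (intro integral_riesz_unit cont) auto
  moreover have "\<Lambda> (\<lambda>x. c * (f x / c)) = c * \<Lambda> (\<lambda>x. f x / c)"
    using c f by (intro scale cont) auto
  ultimately show ?thesis using c by (simp add: field_simps)
qed

end


section \<open>Differences of finite Borel measures\<close>

lemma nonneg_set_function_measure:
  fixes \<nu> :: "'k::topological_space set \<Rightarrow> real"
  assumes "\<nu> {} = 0" "\<And>A. A \<in> sets borel \<Longrightarrow> 0 \<le> \<nu> A"
    and sums: "\<And>A::nat \<Rightarrow> 'k set. \<lbrakk>range A \<subseteq> sets borel; disjoint_family A\<rbrakk>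
      \<Longrightarrow> (\<lambda>n. \<nu> (A n)) sums \<nu> (\<Union>n. A n)"
  defines "R \<equiv> measure_of UNIV (sets borel) (\<lambda>A. ennreal (\<nu> A))"
  shows "sets R = sets borel" "finite_measure R" "\<And>A. A \<in> sets borel \<Longrightarrow> measure R A = \<nu> A"
proof -
  show sets: "sets R = sets borel"
    unfolding R_def by (metis sets.sets_measure_of_eq space_borel)
  have "countably_additive (sets borel) (\<lambda>A. ennreal (\<nu> A))"
    unfolding countably_additive_def
  proof (intro allI impI)
    fix A :: "nat \<Rightarrow> 'k set" assume A: "range A \<subseteq> sets borel" "disjoint_family A"
    then show "(\<Sum>i. ennreal (\<nu> (A i))) = ennreal (\<nu> (\<Union>i. A i))"
      using assms(2) by (intro suminf_ennreal_eq sums) auto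
  qed
  moreover have "positive (sets borel) (\<lambda>A. ennreal (\<nu> A))"
    using assms(1) by (simp add: positive_def)
  ultimately have em: "emeasure R A = ennreal (\<nu> A)" if "A \<in> sets borel" for A
    unfolding R_def using that sets.sigma_algebra_axioms[of borel]
    by (intro emeasure_measure_of_sigma) auto
  have "space R = UNIV" using sets_eq_imp_space_eq[OF sets] by simp
  then show "finite_measure R" by (intro finite_measureI) (simp add: em)
  show "measure R A = \<nu> A" if "A \<in> sets borel" for A
    using em[OF that] assms(2)[OF that] by (simp add: measure_def)
qed

text \<open>Sums stand in for differences, which \<open>ennreal\<close> does not handle well: an
  identity \<open>M - N = Pos - Neg\<close> is used in the form
  \<open>Pos + N = M + Neg\<close>.\<close>

lemma nn_integral_add_measures_cong:
  fixes A B C D :: "'k::topological_space measure"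
  assumes sets: "sets A = sets borel" "sets B = sets borel" "sets C = sets borel" "sets D = sets borel"
    and eq: "\<And>S. S \<in> sets borel \<Longrightarrow> emeasure A S + emeasure B S = emeasure C S + emeasure D S"
    and f: "f \<in> borel_measurable borel"
  shows "(\<integral>\<^sup>+x. f x \<partial>A) + (\<integral>\<^sup>+x. f x \<partial>B) = (\<integral>\<^sup>+x. f x \<partial>C) + (\<integral>\<^sup>+x. f x \<partial>D)"
  using f
proof (induction rule: borel_measurable_induct)
  case (cong f g)
  then have "f = g" by auto
  with cong show ?case by simp
next
  case (set S)
  then show ?case using eq[of S] sets by simp
next
  case (mult u c)
  have m: "u \<in> borel_measurable M" if "sets M = sets borel" for M :: "'k measure"
    using mult measurable_cong_sets[OF that refl] by blast
  show ?case
    using mult.IH by (simp add: nn_integral_cmult m sets flip: distrib_left)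
next
  case (add u v)
  have m: "u \<in> borel_measurable M" "v \<in> borel_measurable M" if "sets M = sets borel" for M :: "'k measure"
    using add measurable_cong_sets[OF that refl] by blast+
  show ?case
    using add.IH by (simp add: nn_integral_add m sets) (metis (no_types, lifting) add.assoc add.left_commute)
next
  case (seq U)
  have m: "U i \<in> borel_measurable M" if "sets M = sets borel" for M :: "'k measure" and i
    using seq measurable_cong_sets[OF that refl] by blast
  have lim: "(\<integral>\<^sup>+x. (SUP i. U i) x \<partial>M) = (SUP i. \<integral>\<^sup>+x. U i x \<partial>M)" if "sets M = sets borel" for M :: "'k measure"
    using nn_integral_monotone_convergence_SUP[OF seq.hyps(3) m[OF that]] by (simp add: image_image)
  have inc: "incseq (\<lambda>i. \<integral>\<^sup>+x. U i x \<partial>M)" for M :: "'k measure"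
    using seq.hyps(3) by (auto simp: incseq_def le_fun_def intro!: nn_integral_mono)
  show ?case
    unfolding lim[OF sets(1)] lim[OF sets(2)] lim[OF sets(3)] lim[OF sets(4)]
      ennreal_SUP_add[OF inc inc, symmetric] seq.IH ..
qed

lemma integral_add_measures_cong:
  fixes A B C D :: "'k::topological_space measure" and f :: "'k \<Rightarrow> real"
  assumes K: "compact (UNIV :: 'k set)"
    and fin: "finite_measure A" "finite_measure B" "finite_measure C" "finite_measure D"
    and sets: "sets A = sets borel" "sets B = sets borel" "sets C = sets borel" "sets D = sets borel"
    and eq: "\<And>S. S \<in> sets borel \<Longrightarrow> measure A S + measure B S = measure C S + measure D S"
    and f: "continuous_on UNIV f"
  shows "(\<integral>x. f x \<partial>A) + (\<integral>x. f x \<partial>B) = (\<integral>x. f x \<partial>C) + (\<integral>x. f x \<partial>D)"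
proof -
  have em: "emeasure A S + emeasure B S = emeasure C S + emeasure D S" if "S \<in> sets borel" for S
    using eq[OF that] fin by (simp add: finite_measure.emeasure_eq_measure flip: ennreal_plus)
  have nonneg: "(\<integral>x. g x \<partial>A) + (\<integral>x. g x \<partial>B) = (\<integral>x. g x \<partial>C) + (\<integral>x. g x \<partial>D)"
    if g: "continuous_on UNIV g" "\<And>x. 0 \<le> g x" for g :: "'k \<Rightarrow> real"
  proof -
    have nn: "(\<integral>\<^sup>+x. ennreal (g x) \<partial>M) = ennreal (\<integral>x. g x \<partial>M)"
      if "finite_measure M" "sets M = sets borel" for M
      using finite_measure_continuous_integrable[OF K g(1) that] g(2)
      by (intro nn_integral_eq_integral) auto
    have ge: "0 \<le> (\<integral>x. g x \<partial>M)" for M using g(2) by (simp add: integral_nonneg)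
    have "(\<lambda>x. ennreal (g x)) \<in> borel_measurable borel"
      using borel_measurable_continuous_onI[OF g(1)] by measurable
    then have "(\<integral>\<^sup>+x. ennreal (g x) \<partial>A) + (\<integral>\<^sup>+x. ennreal (g x) \<partial>B)
        = (\<integral>\<^sup>+x. ennreal (g x) \<partial>C) + (\<integral>\<^sup>+x. ennreal (g x) \<partial>D)"
      using sets em by (intro nn_integral_add_measures_cong)
    then show ?thesis
      using ge by (simp add: nn fin sets flip: ennreal_plus)
  qed
  obtain c where c: "0 < c" "\<And>x. \<bar>f x\<bar> \<le> c"
    using continuous_bounded_compact[OF K f] by blast
  \<comment> \<open>Adding \<open>c\<close> makes the integrand nonnegative; the extra constants
    cancel because \<open>eq\<close> also holds for \<open>UNIV\<close>.\<close>
  have shift: "(\<integral>x. f x + c \<partial>M) = (\<integral>x. f x \<partial>M) + measure M UNIV * c"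
    if "finite_measure M" "sets M = sets borel" for M
    using finite_measure_continuous_integrable[OF K f that] finite_measure.integrable_const[OF that(1), of c]
      sets_eq_imp_space_eq[OF that(2)] by simp
  have "(\<integral>x. f x + c \<partial>A) + (\<integral>x. f x + c \<partial>B) = (\<integral>x. f x + c \<partial>C) + (\<integral>x. f x + c \<partial>D)"
  proof (rule nonneg)
    show "0 \<le> f x + c" for x using c(2)[of x] by simp
  qed (intro continuous_intros f)
  moreover have "(measure A UNIV + measure B UNIV) * c = (measure C UNIV + measure D UNIV) * c"
    using eq[of UNIV] by simp
  ultimately show ?thesis
    unfolding shift[OF fin(1) sets(1)] shift[OF fin(2) sets(2)] shift[OF fin(3) sets(3)]
      shift[OF fin(4) sets(4)] distrib_right by linarith
qed

locale measure_difference = M: finite_measure M + N: finite_measure N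
  for M N :: "'k::t2_space measure" +
  assumes sets_M [measurable_cong, simp]: "sets M = sets borel" and sets_N [measurable_cong, simp]: "sets N = sets borel"
begin

definition diff :: "'k set \<Rightarrow> real" where
  "diff A = measure M A - measure N A"

text \<open>A positive set of a Hahn decomposition is unique only up to null sets, so one is fixed
  by choice.\<close>

definition hahn_set :: "'k set" where
  "hahn_set = (SOME Y. Y \<in> sets borel \<and> (\<forall>X\<in>sets borel. X \<subseteq> Y \<longrightarrow> 0 \<le> diff X) \<and>
     (\<forall>X\<in>sets borel. X \<inter> Y = {} \<longrightarrow> diff X \<le> 0))"

lemma hahn_set:
  shows hahn_set_borel [measurable]: "hahn_set \<in> sets borel"
    and diff_nonneg: "X \<in> sets borel \<Longrightarrow> X \<subseteq> hahn_set \<Longrightarrow> 0 \<le> diff X"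
    and diff_nonpos: "X \<in> sets borel \<Longrightarrow> X \<inter> hahn_set = {} \<Longrightarrow> diff X \<le> 0"
proof -
  have "\<exists>Y\<in>sets M. (\<forall>X\<in>sets M. X \<subseteq> Y \<longrightarrow> N X \<le> M X) \<and> (\<forall>X\<in>sets M. X \<inter> Y = {} \<longrightarrow> M X \<le> N X)"
    by (rule finite_unsigned_Hahn_decomposition) (auto intro: M.finite_measure_axioms N.finite_measure_axioms)
  then have "\<exists>Y. Y \<in> sets borel \<and> (\<forall>X\<in>sets borel. X \<subseteq> Y \<longrightarrow> 0 \<le> diff X) \<and>
     (\<forall>X\<in>sets borel. X \<inter> Y = {} \<longrightarrow> diff X \<le> 0)"
    by (simp add: diff_def M.emeasure_eq_measure N.emeasure_eq_measure) blast
  from someI_ex[OF this] show "hahn_set \<in> sets borel"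
    "X \<in> sets borel \<Longrightarrow> X \<subseteq> hahn_set \<Longrightarrow> 0 \<le> diff X"
    "X \<in> sets borel \<Longrightarrow> X \<inter> hahn_set = {} \<Longrightarrow> diff X \<le> 0"
    unfolding hahn_set_def[symmetric] by blast+
qed

lemma diff_empty [simp]: "diff {} = 0"
  by (simp add: diff_def)

lemma diff_Un:
  assumes "A \<in> sets borel" "B \<in> sets borel" "A \<inter> B = {}"
  shows "diff (A \<union> B) = diff A + diff B"
  using assms by (simp add: diff_def M.finite_measure_Union N.finite_measure_Union)

lemma diff_sums:
  assumes "range A \<subseteq> sets borel" "disjoint_family A"
  shows "(\<lambda>n. diff (A n)) sums diff (\<Union>n. A n)"
  unfolding diff_def using assms by (intro sums_diff M.finite_measure_UNION N.finite_measure_UNION) auto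

definition pos :: "'k set \<Rightarrow> real" where
  "pos A = diff (A \<inter> hahn_set)"

definition neg :: "'k set \<Rightarrow> real" where
  "neg A = - diff (A - hahn_set)"

lemma pos_empty: "pos {} = 0" and neg_empty: "neg {} = 0"
  by (simp_all add: pos_def neg_def)

lemma pos_nonneg: "A \<in> sets borel \<Longrightarrow> 0 \<le> pos A"
  and neg_nonneg: "A \<in> sets borel \<Longrightarrow> 0 \<le> neg A"
  using hahn_set_borel by (auto simp: pos_def neg_def intro!: diff_nonneg diff_nonpos)

lemma diff_eq_pos_neg: "A \<in> sets borel \<Longrightarrow> diff A = pos A - neg A"
  using diff_Un[of "A \<inter> hahn_set" "A - hahn_set"] hahn_set_borel
  by (simp add: pos_def neg_def Int_Diff_Un Diff_disjoint Int_Diff_disjoint sets.Diff)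

lemma pos_sums:
  assumes "range A \<subseteq> sets borel" "disjoint_family A"
  shows "(\<lambda>n. pos (A n)) sums pos (\<Union>n. A n)"
proof -
  have "(\<lambda>n. diff (A n \<inter> hahn_set)) sums diff (\<Union>n. A n \<inter> hahn_set)"
    using assms hahn_set_borel by (intro diff_sums) (auto simp: disjoint_family_on_def)
  then show ?thesis by (simp add: pos_def)
qed

lemma neg_sums:
  assumes "range A \<subseteq> sets borel" "disjoint_family A"
  shows "(\<lambda>n. neg (A n)) sums neg (\<Union>n. A n)"
proof -
  have "(\<lambda>n. diff (A n)) sums diff (\<Union>n. A n)" by (rule diff_sums[OF assms])
  from sums_diff[OF pos_sums[OF assms] this]
  show ?thesis using assms diff_eq_pos_neg by (simp add: range_subsetD sets.countable_UN)
qed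

definition Pos :: "'k measure" where
  "Pos = measure_of UNIV (sets borel) (\<lambda>A. ennreal (pos A))"

definition Neg :: "'k measure" where
  "Neg = measure_of UNIV (sets borel) (\<lambda>A. ennreal (neg A))"

lemma Pos: "sets Pos = sets borel" "finite_measure Pos" "A \<in> sets borel \<Longrightarrow> measure Pos A = pos A"
  unfolding Pos_def
  using nonneg_set_function_measure[of pos] pos_nonneg pos_sums pos_empty by blast+

lemma Neg: "sets Neg = sets borel" "finite_measure Neg" "A \<in> sets borel \<Longrightarrow> measure Neg A = neg A"
  unfolding Neg_def
  using nonneg_set_function_measure[of neg] neg_nonneg neg_sums neg_empty by blast+

text \<open>The supremum is attained at the partition of \<open>A\<close> by the Hahn set; every
  other partition is bounded through \<open>\<bar>diff E\<bar> \<le> pos E + neg E\<close> and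
  finite additivity.\<close>

lemma total_variation_diff:
  assumes A: "A \<in> sets borel"
  shows "total_variation diff A = pos A + neg A"
  unfolding total_variation_def
proof (rule cSup_eq_maximum)
  \<comment> \<open>A partition may not contain the empty block, hence its removal.\<close>
  let ?P = "{A \<inter> hahn_set, A - hahn_set} - {{}}"
  have "(\<Sum>E\<in>?P. \<bar>diff E\<bar>) = (\<Sum>E\<in>{A \<inter> hahn_set, A - hahn_set}. \<bar>diff E\<bar>)"
    by (rule sum.mono_neutral_left) auto
  \<comment> \<open>If the two blocks coincide, the sum over the set has one term instead of two;
    this happens only for empty \<open>A\<close>, where all terms are 0.\<close>
  also have "\<dots> = \<bar>diff (A \<inter> hahn_set)\<bar> + \<bar>diff (A - hahn_set)\<bar>"
  proof (cases "A \<inter> hahn_set = A - hahn_set")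
    case True
    then have "A = {}" by blast
    then show ?thesis by simp
  qed simp
  also have "\<dots> = pos A + neg A"
    using pos_nonneg[OF A] neg_nonneg[OF A] by (simp add: pos_def neg_def)
  finally have "(\<Sum>E\<in>?P. \<bar>diff E\<bar>) = pos A + neg A" .
  moreover have "partition_on A ?P"
    by (auto simp: partition_on_def disjoint_def)
  moreover have "?P \<subseteq> sets borel" using A hahn_set_borel by auto
  ultimately show "pos A + neg A \<in> {\<Sum>E\<in>P. \<bar>diff E\<bar> |P. finite P \<and> partition_on A P \<and> P \<subseteq> sets borel}"
    by (metis (mono_tags, lifting) finite.emptyI finite_Diff finite_insert mem_Collect_eq)
next
  fix s assume "s \<in> {\<Sum>E\<in>P. \<bar>diff E\<bar> |P. finite P \<and> partition_on A P \<and> P \<subseteq> sets borel}"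
  then obtain P where P: "s = (\<Sum>E\<in>P. \<bar>diff E\<bar>)" "finite P" "partition_on A P" "P \<subseteq> sets borel" by blast
  have "s \<le> (\<Sum>E\<in>P. pos E + neg E)"
    unfolding P(1)
  proof (rule sum_mono)
    fix E assume "E \<in> P"
    then have E: "E \<in> sets borel" using P(4) by blast
    show "\<bar>diff E\<bar> \<le> pos E + neg E"
      using pos_nonneg[OF E] neg_nonneg[OF E] by (simp add: diff_eq_pos_neg[OF E])
  qed
  also have "\<dots> = (\<Sum>E\<in>P. measure Pos E) + (\<Sum>E\<in>P. measure Neg E)"
    unfolding sum.distrib using P(4) by (intro arg_cong2[where f = "(+)"] sum.cong) (auto simp: Pos Neg)
  also have "(\<Sum>E\<in>P. measure Pos E) = measure Pos (\<Union>E\<in>P. E)"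
    using P partition_onD2[OF P(3)] Pos(1)
    by (intro finite_measure.finite_measure_finite_Union[OF Pos(2), symmetric])
      (auto simp: disjoint_family_on_def disjoint_def)
  also have "(\<Sum>E\<in>P. measure Neg E) = measure Neg (\<Union>E\<in>P. E)"
    using P partition_onD2[OF P(3)] Neg(1)
    by (intro finite_measure.finite_measure_finite_Union[OF Neg(2), symmetric])
      (auto simp: disjoint_family_on_def disjoint_def)
  also have "(\<Union>E\<in>P. E) = A" using partition_onD1[OF P(3)] by simp
  finally show "s \<le> pos A + neg A" using A by (simp add: Pos Neg)
qed

lemma pos_part_diff: "A \<in> sets borel \<Longrightarrow> pos_part diff A = pos A"
  and neg_part_diff: "A \<in> sets borel \<Longrightarrow> neg_part diff A = neg A"
  by (simp_all add: pos_part_def neg_part_def total_variation_diff diff_eq_pos_neg)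

lemma pos_le: "A \<in> sets borel \<Longrightarrow> pos A \<le> measure M A"
proof -
  assume A: "A \<in> sets borel"
  have "pos A \<le> measure M (A \<inter> hahn_set)" by (simp add: pos_def diff_def)
  also have "\<dots> \<le> measure M A" using A by (intro M.finite_measure_mono) auto
  finally show ?thesis .
qed

lemma neg_le: "A \<in> sets borel \<Longrightarrow> neg A \<le> measure N A"
proof -
  assume A: "A \<in> sets borel"
  have "neg A \<le> measure N (A - hahn_set)" by (simp add: neg_def diff_def)
  also have "\<dots> \<le> measure N A" using A by (intro N.finite_measure_mono) auto
  finally show ?thesis .
qed

lemma signed_borel_measure_diff: "signed_borel_measure diff"
  unfolding signed_borel_measure_def using diff_sums by (auto simp: diff_def measure_notin_sets)

text \<open>\<open>signed_integral\<close> is defined through the Jordan parts, whereas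
  \<open>M\<close> and \<open>N\<close> may overlap. The two differences agree on Borel sets, and
  moving the negative terms across turns this into equality of two sums of finite measures.\<close>

lemma signed_integral_diff:
  assumes "compact (UNIV :: 'k set)" "continuous_on UNIV f"
  shows "signed_integral diff f = (\<integral>x. f x \<partial>M) - (\<integral>x. f x \<partial>N)"
proof -
  have "measure_of UNIV (sets borel) (\<lambda>A. ennreal (pos_part diff A)) = Pos"
    "measure_of UNIV (sets borel) (\<lambda>A. ennreal (neg_part diff A)) = Neg"
    unfolding Pos_def Neg_def
    using sets.sigma_sets_eq[of "borel :: 'k measure"]
    by (auto intro!: measure_of_eq simp: pos_part_diff neg_part_diff)
  then have "signed_integral diff f = (\<integral>x. f x \<partial>Pos) - (\<integral>x. f x \<partial>Neg)"
    by (simp add: signed_integral_def)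
  moreover have "measure Pos S + measure N S = measure M S + measure Neg S" if "S \<in> sets borel" for S
    using diff_eq_pos_neg[OF that] that by (simp add: Pos Neg diff_def)
  then have "(\<integral>x. f x \<partial>Pos) + (\<integral>x. f x \<partial>N) = (\<integral>x. f x \<partial>M) + (\<integral>x. f x \<partial>Neg)"
    by (intro integral_add_measures_cong assms Pos Neg M.finite_measure_axioms N.finite_measure_axioms) simp_all
  ultimately show ?thesis by simp
qed

text \<open>The variation is at most \<open>M + N\<close>, so intersecting open approximations for
  \<open>M\<close> and \<open>N\<close> gives outer regularity. Inner regularity follows by
  complements: in a compact space the complement of an open set around \<open>- A\<close> is a
  compact subset of \<open>A\<close>.\<close>

lemma regular_diff:
  assumes K: "compact (UNIV :: 'k set)"
    and M: "\<And>A e. \<lbrakk>A \<in> sets borel; 0 < e\<rbrakk> \<Longrightarrow> \<exists>U. open U \<and> A \<subseteq> U \<and> measure M (U - A) \<le> e"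
    and N: "\<And>A e. \<lbrakk>A \<in> sets borel; 0 < e\<rbrakk> \<Longrightarrow> \<exists>U. open U \<and> A \<subseteq> U \<and> measure N (U - A) \<le> e"
  shows "regular_signed_measure diff"
proof -
  have outer: "\<exists>U. open U \<and> A \<subseteq> U \<and> total_variation diff (U - A) \<le> e"
    if A: "A \<in> sets borel" and e: "0 < e" for A and e :: real
  proof -
    obtain U V where U: "open U" "A \<subseteq> U" "measure M (U - A) \<le> e / 2"
      and V: "open V" "A \<subseteq> V" "measure N (V - A) \<le> e / 2"
      using M[OF A, of "e / 2"] N[OF A, of "e / 2"] e by auto
    have b: "U \<inter> V - A \<in> sets borel" "U - A \<in> sets borel" "V - A \<in> sets borel" using U V A by auto
    have "total_variation diff (U \<inter> V - A) \<le> measure M (U \<inter> V - A) + measure N (U \<inter> V - A)"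
      using b(1) by (simp add: total_variation_diff pos_le neg_le add_mono)
    also have "\<dots> \<le> measure M (U - A) + measure N (V - A)"
      using b by (intro add_mono M.finite_measure_mono N.finite_measure_mono) auto
    also have "\<dots> \<le> e" using U V by simp
    finally show ?thesis using U V by (intro exI[of _ "U \<inter> V"]) auto
  qed
  have split: "total_variation diff B = total_variation diff A + total_variation diff (B - A)"
    if "A \<in> sets borel" "B \<in> sets borel" "A \<subseteq> B" for A B
  proof -
    have "measure Pos (B - A) = measure Pos B - measure Pos A"
      "measure Neg (B - A) = measure Neg B - measure Neg A"
      using that Pos(1) Neg(1) finite_measure.finite_measure_Diff[OF Pos(2)]
        finite_measure.finite_measure_Diff[OF Neg(2)] by auto
    then show ?thesis using that by (simp add: total_variation_diff Pos Neg)
  qed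
  have nonneg: "0 \<le> total_variation diff A" if "A \<in> sets borel" for A
    using that by (simp add: total_variation_diff pos_nonneg neg_nonneg)
  show ?thesis
    unfolding regular_signed_measure_def
  proof (intro ballI conjI antisym)
    fix A :: "'k set" assume A: "A \<in> sets borel"
    have mono: "total_variation diff A \<le> total_variation diff U" if "U \<in> sets borel" "A \<subseteq> U" for U
      using split[OF A that] nonneg[of "U - A"] that A by auto
    have mono': "total_variation diff C \<le> total_variation diff A" if "compact C" "C \<subseteq> A" for C
      using split[OF _ A that(2)] nonneg[of "A - C"] that A compact_imp_closed[OF that(1)] by auto
    show "total_variation diff A \<le> (INF U\<in>{U. open U \<and> A \<subseteq> U}. total_variation diff U)"
      using mono by (intro cINF_greatest) auto
    show "(INF U\<in>{U. open U \<and> A \<subseteq> U}. total_variation diff U) \<le> total_variation diff A"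
    proof (rule field_le_epsilon)
      fix e :: real assume "0 < e"
      then obtain U where U: "open U" "A \<subseteq> U" "total_variation diff (U - A) \<le> e" using outer[OF A] by blast
      have "(INF U\<in>{U. open U \<and> A \<subseteq> U}. total_variation diff U) \<le> total_variation diff U"
        using U nonneg by (intro cINF_lower bdd_belowI2[where m = 0]) auto
      also have "\<dots> \<le> total_variation diff A + e" using split[OF A _ U(2)] U by simp
      finally show "(INF U\<in>{U. open U \<and> A \<subseteq> U}. total_variation diff U) \<le> total_variation diff A + e" .
    qed
    show "(SUP C\<in>{C. compact C \<and> C \<subseteq> A}. total_variation diff C) \<le> total_variation diff A"
      using mono' by (intro cSUP_least) (auto intro: exI[of _ "{}"])
    show "total_variation diff A \<le> (SUP C\<in>{C. compact C \<and> C \<subseteq> A}. total_variation diff C)"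
    proof (rule field_le_epsilon)
      fix e :: real assume "0 < e"
      then obtain U where U: "open U" "- A \<subseteq> U" "total_variation diff (U - - A) \<le> e"
        using outer[of "- A"] A by auto
      have C: "compact (- U)" "- U \<subseteq> A"
        using K U compact_Int_closed[of UNIV "- U"] by auto
      have "total_variation diff A = total_variation diff (- U) + total_variation diff (A - - U)"
        using C A U by (intro split) auto
      also have "A - - U = U - - A" by auto
      also have "total_variation diff (- U) + total_variation diff (U - - A)
          \<le> (SUP C\<in>{C. compact C \<and> C \<subseteq> A}. total_variation diff C) + e"
        using C U mono' by (intro add_mono cSUP_upper bdd_aboveI2[where M = "total_variation diff A"]) auto
      finally show "total_variation diff A \<le> (SUP C\<in>{C. compact C \<and> C \<subseteq> A}. total_variation diff C) + e" .
    qed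
  qed
qed

end


section \<open>Comparison of integrals and signed integrals against nonnegative measures\<close>

lemma integral_mono_finite_measures:
  fixes f :: "'k::topological_space \<Rightarrow> real"
  assumes K: "compact (UNIV :: 'k set)"
    and fin: "finite_measure R" "finite_measure M"
    and sets: "sets R = sets borel" "sets M = sets borel"
    and le: "\<And>A. A \<in> sets borel \<Longrightarrow> measure R A \<le> measure M A"
    and f: "continuous_on UNIV f" "\<And>x. 0 \<le> f x"
  shows "(\<integral>x. f x \<partial>R) \<le> (\<integral>x. f x \<partial>M)"
proof -
  have nn: "(\<integral>\<^sup>+x. ennreal (f x) \<partial>Q) = ennreal (\<integral>x. f x \<partial>Q)"
    if "finite_measure Q" "sets Q = sets borel" for Q
    using finite_measure_continuous_integrable[OF K f(1) that] f(2)
    by (intro nn_integral_eq_integral) auto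
  have "emeasure R A \<le> emeasure M A" for A
  proof (cases "A \<in> sets borel")
    case True
    then show ?thesis
      using le fin by (simp add: finite_measure.emeasure_eq_measure ennreal_leI)
  next
    case False
    then show ?thesis using sets by (simp add: emeasure_notin_sets)
  qed
  then have "R \<le> M"
    using sets sets_eq_imp_space_eq[of R M] by (simp add: le_measure_iff le_fun_def)
  then have "(\<integral>\<^sup>+x. ennreal (f x) \<partial>R) \<le> (\<integral>\<^sup>+x. ennreal (f x) \<partial>M)"
    using sets by (intro nn_integral_mono_measure) auto
  moreover have "0 \<le> (\<integral>x. f x \<partial>M)" using f(2) by (simp add: integral_nonneg)
  ultimately show ?thesis by (simp add: nn fin sets)
qed

text \<open>Reading \<open>\<nu>\<close> as the difference of \<open>R\<close> and the null measure
  makes \<open>signed_integral_diff\<close> applicable, so that the Jordan decomposition need not be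
  computed.\<close>

lemma signed_integral_nonneg_measure:
  fixes \<nu> :: "'k::t2_space set \<Rightarrow> real"
  assumes K: "compact (UNIV :: 'k set)"
    and \<nu>: "signed_borel_measure \<nu>" "\<And>A. A \<in> sets borel \<Longrightarrow> 0 \<le> \<nu> A"
  obtains R where "sets R = sets borel" "finite_measure R" "\<And>A. A \<in> sets borel \<Longrightarrow> measure R A = \<nu> A"
    "\<And>f. continuous_on UNIV f \<Longrightarrow> signed_integral \<nu> f = (\<integral>x. f x \<partial>R)"
proof -
  define R where "R = measure_of UNIV (sets borel) (\<lambda>A. ennreal (\<nu> A))"
  have R: "sets R = sets borel" "finite_measure R" "\<And>A. A \<in> sets borel \<Longrightarrow> measure R A = \<nu> A"
    using nonneg_set_function_measure[of \<nu>] \<nu> unfolding signed_borel_measure_def R_def by blast+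
  interpret R: measure_difference R "null_measure borel"
    using R by (intro measure_difference.intro measure_difference_axioms.intro) (auto intro: finite_measureI)
  have "R.diff A = \<nu> A" for A
  proof (cases "A \<in> sets borel")
    case False
    then show ?thesis
      using \<nu>(1) R(1) by (simp add: R.diff_def measure_notin_sets signed_borel_measure_def)
  qed (simp add: R.diff_def R measure_def[of "null_measure _"])
  then have "R.diff = \<nu>" by blast
  moreover have "signed_integral R.diff f = (\<integral>x. f x \<partial>R)" if "continuous_on UNIV f" for f
    using R.signed_integral_diff[OF K that] by simp
  ultimately have "signed_integral \<nu> f = (\<integral>x. f x \<partial>R)" if "continuous_on UNIV f" for f
    using that by simp
  with R show ?thesis by (rule that)
qed

lemma signed_integral_zero:
  assumes K: "compact (UNIV :: 'k::t2_space set)" and f: "continuous_on UNIV (f :: 'k \<Rightarrow> real)"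
  shows "signed_integral (\<lambda>_. 0) f = 0"
proof -
  interpret Z: measure_difference "null_measure (borel :: 'k measure)" "null_measure borel"
    by (intro measure_difference.intro measure_difference_axioms.intro) (auto intro: finite_measureI)
  have "Z.diff = (\<lambda>_. 0)" by (auto simp: Z.diff_def)
  then show ?thesis using Z.signed_integral_diff[OF K f] by simp
qed

section \<open>Riesz representation for functionals of norm at most one\<close>

text \<open>Functionals act on plain functions, and only their values at continuous ones are
  constrained. The last axiom expresses norm at most one through pointwise bounds, without a
  supremum norm.\<close>

locale contractive_functional =
  fixes \<phi> :: "('k::t2_space \<Rightarrow> real) \<Rightarrow> real"
  assumes compact: "compact (UNIV :: 'k set)"
    and add: "\<lbrakk>continuous_on UNIV f; continuous_on UNIV g\<rbrakk> \<Longrightarrow> \<phi> (\<lambda>x. f x + g x) = \<phi> f + \<phi> g"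
    and scale: "continuous_on UNIV f \<Longrightarrow> \<phi> (\<lambda>x. a * f x) = a * \<phi> f"
    and bound: "\<lbrakk>continuous_on UNIV f; \<And>x. \<bar>f x\<bar> \<le> b\<rbrakk> \<Longrightarrow> \<bar>\<phi> f\<bar> \<le> b"
begin

lemma sub:
  assumes "continuous_on UNIV f" "continuous_on UNIV g"
  shows "\<phi> (\<lambda>x. f x - g x) = \<phi> f - \<phi> g"
proof -
  have "\<phi> (\<lambda>x. f x + (-1) * g x) = \<phi> f + \<phi> (\<lambda>x. (-1) * g x)"
    using assms by (intro add continuous_intros)
  then show ?thesis using scale[OF assms(2), of "-1"] by simp
qed

definition minorants :: "('k \<Rightarrow> real) \<Rightarrow> ('k \<Rightarrow> real) set" where
  "minorants f = {g. continuous_on UNIV g \<and> (\<forall>x. 0 \<le> g x \<and> g x \<le> f x)}"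

text \<open>The Riesz-Kantorovich formula for the positive part of \<open>\<phi>\<close>, meaningful
  for nonnegative \<open>f\<close>.\<close>

definition pos_functional :: "('k \<Rightarrow> real) \<Rightarrow> real" where
  "pos_functional f = (SUP g\<in>minorants f. \<phi> g)"

lemma minorants_bdd:
  assumes "continuous_on UNIV f"
  shows "bdd_above (\<phi> ` minorants f)"
proof -
  obtain c where c: "0 < c" "\<And>x. \<bar>f x\<bar> \<le> c"
    using continuous_bounded_compact[OF compact assms] by blast
  have "\<phi> g \<le> c" if "g \<in> minorants f" for g
  proof -
    have "\<bar>\<phi> g\<bar> \<le> c"
    proof (rule bound)
      show "continuous_on UNIV g" using that by (simp add: minorants_def)
      show "\<bar>g x\<bar> \<le> c" for x
        using that c(2)[of x] unfolding minorants_def by (auto simp: abs_le_iff intro: order_trans)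
    qed
    then show ?thesis by simp
  qed
  then show ?thesis by (intro bdd_aboveI2)
qed

lemma pos_functional_upper:
  "\<lbrakk>continuous_on UNIV f; g \<in> minorants f\<rbrakk> \<Longrightarrow> \<phi> g \<le> pos_functional f"
  unfolding pos_functional_def by (rule cSUP_upper[OF _ minorants_bdd])

lemma pos_functional_least:
  assumes "\<And>x. 0 \<le> f x" "\<And>g. g \<in> minorants f \<Longrightarrow> \<phi> g \<le> c"
  shows "pos_functional f \<le> c"
  unfolding pos_functional_def
proof (rule cSUP_least)
  have "(\<lambda>_. 0) \<in> minorants f" using assms(1) by (simp add: minorants_def)
  then show "minorants f \<noteq> {}" by blast
qed (rule assms)

text \<open>Riesz decomposition: a minorant \<open>h\<close> of \<open>f + g\<close> splits as
  \<open>min h f\<close>, a minorant of \<open>f\<close>, and the rest, a minorant of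
  \<open>g\<close>. Conversely, minorants of the two add up.\<close>

lemma pos_functional_add:
  assumes f: "continuous_on UNIV f" "\<And>x. 0 \<le> f x" and g: "continuous_on UNIV g" "\<And>x. 0 \<le> g x"
  shows "pos_functional (\<lambda>x. f x + g x) = pos_functional f + pos_functional g"
proof (rule antisym)
  have cont: "continuous_on UNIV (\<lambda>x. f x + g x)" by (intro continuous_intros f g)
  show "pos_functional (\<lambda>x. f x + g x) \<le> pos_functional f + pos_functional g"
  proof (rule pos_functional_least)
    fix h assume h: "h \<in> minorants (\<lambda>x. f x + g x)"
    have 1: "(\<lambda>x. min (h x) (f x)) \<in> minorants f"
      using h f by (auto simp: minorants_def intro!: continuous_intros)
    have 2: "(\<lambda>x. h x - min (h x) (f x)) \<in> minorants g"
      unfolding minorants_def mem_Collect_eq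
    proof (intro conjI allI)
      show "continuous_on UNIV (\<lambda>x. h x - min (h x) (f x))"
        using h f by (auto simp: minorants_def intro!: continuous_intros)
      show "h x - min (h x) (f x) \<le> g x" for x
        using h g(2)[of x] unfolding minorants_def by (auto simp: min_def algebra_simps)
    qed auto
    have "\<phi> (\<lambda>x. min (h x) (f x) + (h x - min (h x) (f x)))
        = \<phi> (\<lambda>x. min (h x) (f x)) + \<phi> (\<lambda>x. h x - min (h x) (f x))"
      using 1 2 by (intro add) (auto simp: minorants_def)
    then show "\<phi> h \<le> pos_functional f + pos_functional g"
      using pos_functional_upper[OF f(1) 1] pos_functional_upper[OF g(1) 2] by simp
  qed (simp add: f g)
  have super: "\<phi> u + \<phi> v \<le> pos_functional (\<lambda>x. f x + g x)" if "u \<in> minorants f" "v \<in> minorants g" for u v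
  proof -
    have "(\<lambda>x. u x + v x) \<in> minorants (\<lambda>x. f x + g x)"
      using that by (auto simp: minorants_def intro!: continuous_intros add_mono)
    from pos_functional_upper[OF cont this] show ?thesis
      using that by (simp add: minorants_def add)
  qed
  then have "pos_functional g \<le> pos_functional (\<lambda>x. f x + g x) - \<phi> u" if "u \<in> minorants f" for u
    by (intro pos_functional_least g) (use super[OF that] in \<open>force simp: algebra_simps\<close>)
  then have "pos_functional f \<le> pos_functional (\<lambda>x. f x + g x) - pos_functional g"
    by (intro pos_functional_least f) (force simp: algebra_simps)
  then show "pos_functional f + pos_functional g \<le> pos_functional (\<lambda>x. f x + g x)" by simp
qed

lemma pos_functional_scale_le:
  assumes f: "continuous_on UNIV f" "\<And>x. 0 \<le> f x" and a: "0 < a"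
  shows "a * pos_functional f \<le> pos_functional (\<lambda>x. a * f x)"
proof -
  have "\<phi> g \<le> pos_functional (\<lambda>x. a * f x) / a" if g: "g \<in> minorants f" for g
  proof -
    have "(\<lambda>x. a * g x) \<in> minorants (\<lambda>x. a * f x)"
      using g a by (auto simp: minorants_def intro!: continuous_intros)
    then have "\<phi> (\<lambda>x. a * g x) \<le> pos_functional (\<lambda>x. a * f x)"
      by (intro pos_functional_upper continuous_intros f)
    then show ?thesis using g a by (simp add: minorants_def scale field_simps)
  qed
  then have "pos_functional f \<le> pos_functional (\<lambda>x. a * f x) / a"
    by (intro pos_functional_least f)
  then show ?thesis using a by (simp add: field_simps)
qed

lemma pos_functional_scale:
  assumes f: "continuous_on UNIV f" "\<And>x. 0 \<le> f x" and a: "0 \<le> a"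
  shows "pos_functional (\<lambda>x. a * f x) = a * pos_functional f"
proof (cases "a = 0")
  case True
  have "pos_functional (\<lambda>x. 0 + 0) = pos_functional (\<lambda>x. 0) + pos_functional (\<lambda>x. 0)"
    by (intro pos_functional_add) auto
  with True show ?thesis by simp
next
  case False
  then have a: "0 < a" using a by simp
  have "inverse a * pos_functional (\<lambda>x. a * f x) \<le> pos_functional (\<lambda>x. inverse a * (a * f x))"
    using a f by (intro pos_functional_scale_le continuous_intros) auto
  then have "pos_functional (\<lambda>x. a * f x) \<le> a * pos_functional f"
    using a by (simp add: field_simps)
  then show ?thesis using pos_functional_scale_le[OF f a] by simp
qed

lemma pos_functional_nonneg:
  assumes "continuous_on UNIV f" "\<And>x. 0 \<le> f x"
  shows "0 \<le> pos_functional f" "\<phi> f \<le> pos_functional f"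
proof -
  have "\<phi> (\<lambda>x. 0) = 0" using scale[of "\<lambda>_. 0" 0] by simp
  then show "0 \<le> pos_functional f"
    using pos_functional_upper[of f "\<lambda>_. 0"] assms by (simp add: minorants_def)
  show "\<phi> f \<le> pos_functional f"
    using pos_functional_upper[of f f] assms by (simp add: minorants_def)
qed

definition neg_functional :: "('k \<Rightarrow> real) \<Rightarrow> real" where
  "neg_functional f = pos_functional f - \<phi> f"

sublocale pos: positive_functional pos_functional
  by unfold_locales
    (auto simp: compact pos_functional_add pos_functional_scale pos_functional_nonneg)

sublocale neg: positive_functional neg_functional
  by unfold_locales
    (auto simp: compact pos_functional_add pos_functional_scale pos_functional_nonneg
      neg_functional_def add scale right_diff_distrib)

text \<open>For \<open>0 \<le> g \<le> 1\<close> the function \<open>2 g - 1\<close> is bounded by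
  1, hence \<open>2 \<phi> g - \<phi> 1 \<le> 1\<close>. In other words, the masses of the positive
  and negative parts add up to at most one, which puts the representing measure into the unit
  ball.\<close>

lemma pos_functional_one: "2 * pos_functional (\<lambda>_. 1) \<le> 1 + \<phi> (\<lambda>_. 1)"
proof -
  have "pos_functional (\<lambda>_. 1) \<le> (1 + \<phi> (\<lambda>_. 1)) / 2"
  proof (rule pos_functional_least)
    fix g assume g: "g \<in> minorants (\<lambda>_. 1)"
    then have "\<bar>\<phi> (\<lambda>x. 2 * g x - 1)\<bar> \<le> 1"
      by (intro bound) (auto simp: minorants_def abs_le_iff intro!: continuous_intros)
    moreover have "\<phi> (\<lambda>x. 2 * g x - 1) = 2 * \<phi> g - \<phi> (\<lambda>_. 1)"
      using g by (subst sub) (auto simp: minorants_def scale intro!: continuous_intros)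
    ultimately show "\<phi> g \<le> (1 + \<phi> (\<lambda>_. 1)) / 2" by simp
  qed simp
  then show ?thesis by simp
qed

sublocale representing: measure_difference pos.riesz_measure neg.riesz_measure
  by (intro measure_difference.intro measure_difference_axioms.intro)
    (auto intro: pos.riesz.finite_measure_axioms neg.riesz.finite_measure_axioms)

abbreviation representing_measure :: "'k set \<Rightarrow> real" where
  "representing_measure \<equiv> representing.diff"

lemma signed_integral_representing:
  assumes f: "continuous_on UNIV f"
  shows "signed_integral representing_measure f = \<phi> f"
proof -
  obtain c where c: "0 < c" "\<And>x. \<bar>f x\<bar> \<le> c"
    using continuous_bounded_compact[OF compact f] by blast
  have *: "signed_integral representing_measure g = \<phi> g" if "continuous_on UNIV g" "\<And>x. 0 \<le> g x" for g
    using that by (simp add: representing.signed_integral_diff[OF compact] pos.integral_riesz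
        neg.integral_riesz neg_functional_def)
  have "signed_integral representing_measure (\<lambda>x. f x + c) =
      signed_integral representing_measure f + signed_integral representing_measure (\<lambda>_. c)"
    using f by (simp add: representing.signed_integral_diff[OF compact] continuous_intros
        pos.integrable_riesz neg.integrable_riesz)
  moreover have "signed_integral representing_measure (\<lambda>x. f x + c) = \<phi> (\<lambda>x. f x + c)"
  proof (rule *)
    show "0 \<le> f x + c" for x using c(2)[of x] by simp
  qed (intro continuous_intros f)
  moreover have "signed_integral representing_measure (\<lambda>x. c) = \<phi> (\<lambda>x. c)"
    using c by (intro *) auto
  ultimately show ?thesis
    using f by (simp add: add)
qed

lemma representing_measure_ball: "representing_measure \<in> signed_measures_ball"
proof -
  have "regular_signed_measure representing_measure"
    by (rule representing.regular_diff[OF compact])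
      (use pos.riesz_outer_regular neg.riesz_outer_regular in metis)+
  moreover have "total_variation representing_measure UNIV \<le> 1"
  proof -
    have "total_variation representing_measure UNIV
        \<le> measure pos.riesz_measure UNIV + measure neg.riesz_measure UNIV"
      using representing.pos_le[of UNIV] representing.neg_le[of UNIV]
      by (simp add: representing.total_variation_diff)
    then show ?thesis
      using pos_functional_one
      by (simp add: pos.measure_riesz_UNIV neg.measure_riesz_UNIV neg_functional_def)
  qed
  ultimately show ?thesis
    by (simp add: signed_measures_ball_def signed_measures_def representing.signed_borel_measure_diff)
qed

lemma representing_UNIV: "representing_measure UNIV = \<phi> (\<lambda>_. 1)"
  by (simp add: representing.diff_def pos.measure_riesz_UNIV neg.measure_riesz_UNIV neg_functional_def)

lemma compensation_nonpos:
  assumes "is_compensation \<nu> representing_measure" "\<phi> (\<lambda>_. 1) \<le> 0" "continuous_on UNIV f"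
  shows "signed_integral \<nu> f = 0"
  using assms signed_integral_zero[OF compact assms(3)]
  by (simp add: is_compensation_def representing_UNIV)

text \<open>On Borel sets \<open>\<nu>\<close> lies between 0 and the Jordan positive part, which is
  dominated by the Riesz measure of \<open>pos_functional\<close>. Domination suffices: whether the
  two Riesz measures are mutually singular never has to be decided.\<close>

lemma compensation_pos:
  assumes \<nu>: "is_compensation \<nu> representing_measure" and one: "0 < \<phi> (\<lambda>_. 1)"
  shows "\<lbrakk>continuous_on UNIV f; continuous_on UNIV g\<rbrakk> \<Longrightarrow>
      signed_integral \<nu> (\<lambda>x. f x + g x) = signed_integral \<nu> f + signed_integral \<nu> g"
    and "continuous_on UNIV f \<Longrightarrow> signed_integral \<nu> (\<lambda>x. a * f x) = a * signed_integral \<nu> f"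
    and "\<lbrakk>continuous_on UNIV f; \<And>x. 0 \<le> f x\<rbrakk> \<Longrightarrow> 0 \<le> signed_integral \<nu> f"
    and "\<lbrakk>continuous_on UNIV f; \<And>x. 0 \<le> f x\<rbrakk> \<Longrightarrow> signed_integral \<nu> f \<le> pos_functional f"
    and "signed_integral \<nu> (\<lambda>_. 1) = \<phi> (\<lambda>_. 1)"
proof -
  have sb: "signed_borel_measure \<nu>"
    and between: "\<And>A. A \<in> sets borel \<Longrightarrow> 0 \<le> \<nu> A \<and> \<nu> A \<le> representing.pos A"
    and mass: "\<nu> UNIV = \<phi> (\<lambda>_. 1)"
    using \<nu> one
    by (auto simp: is_compensation_def representing_UNIV signed_measures_def representing.pos_part_diff)
  obtain R where R: "sets R = sets borel" "finite_measure R" "\<And>A. A \<in> sets borel \<Longrightarrow> measure R A = \<nu> A"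
    and int: "\<And>f. continuous_on UNIV f \<Longrightarrow> signed_integral \<nu> f = (\<integral>x. f x \<partial>R)"
    using signed_integral_nonneg_measure[OF compact sb] between by blast
  have integrable: "integrable R f" if "continuous_on UNIV f" for f :: "'k \<Rightarrow> real"
    by (rule finite_measure_continuous_integrable[OF compact that R(2,1)])
  show "signed_integral \<nu> (\<lambda>x. f x + g x) = signed_integral \<nu> f + signed_integral \<nu> g"
    if "continuous_on UNIV f" "continuous_on UNIV g"
    using that integrable by (simp add: int continuous_intros)
  show "signed_integral \<nu> (\<lambda>x. a * f x) = a * signed_integral \<nu> f" if "continuous_on UNIV f"
    using that by (simp add: int continuous_intros)
  show "0 \<le> signed_integral \<nu> f" if "continuous_on UNIV f" "\<And>x. 0 \<le> f x"
    using that by (simp add: int integral_nonneg)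
  show "signed_integral \<nu> f \<le> pos_functional f" if f: "continuous_on UNIV f" "\<And>x. 0 \<le> f x"
  proof -
    have "measure R A \<le> measure pos.riesz_measure A" if "A \<in> sets borel" for A
      using between[OF that] R(3)[OF that] representing.pos_le[OF that] by simp
    then have "(\<integral>x. f x \<partial>R) \<le> (\<integral>x. f x \<partial>pos.riesz_measure)"
      by (intro integral_mono_finite_measures compact R f pos.riesz.finite_measure_axioms) auto
    then show ?thesis using f by (simp add: int pos.integral_riesz)
  qed
  have "space R = UNIV" using sets_eq_imp_space_eq[OF R(1)] by simp
  then show "signed_integral \<nu> (\<lambda>_. 1) = \<phi> (\<lambda>_. 1)"
    using int[of "\<lambda>_. 1"] R(3)[of UNIV] mass by simp
qed

text \<open>With \<open>p\<close> the mass of the positive part and \<open>m\<close> that of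
  \<open>\<phi>\<close>, the difference is \<open>(\<phi>\<^sup>+ - J) - \<phi>\<^sup>-\<close>,
  where both terms are positive of mass \<open>p - m\<close>. Its norm is therefore at most
  \<open>2 (p - m)\<close>, and \<open>2 p \<le> 1 + m\<close> turns this into
  \<open>1 - m\<close>.\<close>

lemma compensation_close:
  assumes \<nu>: "is_compensation \<nu> representing_measure" and one: "0 < \<phi> (\<lambda>_. 1)"
    and f: "continuous_on UNIV f" "\<And>x. \<bar>f x\<bar> \<le> b"
  shows "\<bar>\<phi> f - signed_integral \<nu> f\<bar> \<le> b * (1 - \<phi> (\<lambda>_. 1))"
proof -
  note J = compensation_pos[OF \<nu> one]
  let ?J = "signed_integral \<nu>" and ?p = "pos_functional (\<lambda>_. 1)" and ?m = "\<phi> (\<lambda>_. 1)"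
  have b: "0 \<le> b" using f(2)[of undefined] by simp
  have f': "- b \<le> f x" "f x \<le> b" for x using f(2)[of x] by auto
  \<comment> \<open>Both shifts of \<open>f\<close> are nonnegative and add up to the constant
    \<open>2 b\<close>: an upper estimate for one is a lower estimate for the other.\<close>
  define h where "h = (\<lambda>x. f x + b)"
  define k where "k = (\<lambda>x. b - f x)"
  have h: "continuous_on UNIV h" "\<And>x. 0 \<le> h x" and k: "continuous_on UNIV k" "\<And>x. 0 \<le> k x"
    using f' by (auto simp: h_def k_def algebra_simps intro!: continuous_intros f) (smt (verit))+
  have hk: "(\<lambda>x. h x + k x) = (\<lambda>x. 2 * b * 1)" by (auto simp: h_def k_def)
  have Pk: "pos_functional h + pos_functional k = 2 * b * ?p"
    using pos_functional_add[OF h k] pos_functional_scale[of "\<lambda>_. 1" "2 * b"] b hk by simp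
  have Jk: "?J h + ?J k = 2 * b * ?m"
    using J(1)[OF h(1) k(1)] J(2)[of "\<lambda>_. 1" "2 * b"] J(5) hk by simp
  have \<phi>k: "\<phi> h + \<phi> k = 2 * b * ?m"
    using add[OF h(1) k(1)] scale[of "\<lambda>_. 1" "2 * b"] hk by simp
  have hb: "\<phi> h = \<phi> f + b * ?m" "?J h = ?J f + b * ?m"
    using add[OF f(1), of "\<lambda>_. b"] scale[of "\<lambda>_. 1" b] J(1)[OF f(1), of "\<lambda>_. b"] J(2)[of "\<lambda>_. 1" b] J(5)
    by (simp_all add: h_def)
  have "\<phi> h - ?J h \<le> pos_functional h - ?J h"
    using pos_functional_nonneg[OF h] by simp
  also have "\<dots> \<le> 2 * b * (?p - ?m)"
    using J(4)[OF k] Pk Jk by (simp add: algebra_simps)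
  finally have up: "\<phi> f - ?J f \<le> 2 * b * (?p - ?m)" using hb by simp
  have "\<phi> h - ?J h = ?J k - \<phi> k" using Jk \<phi>k by simp
  moreover have "\<phi> k - ?J k \<le> 2 * b * (?p - ?m)"
    using pos_functional_nonneg[OF k] J(4)[OF h] Pk Jk by (simp add: algebra_simps)
  ultimately have lo: "- (2 * b * (?p - ?m)) \<le> \<phi> f - ?J f" using hb by simp
  have "2 * b * (?p - ?m) = b * (2 * ?p - 2 * ?m)" by (simp add: algebra_simps)
  also have "\<dots> \<le> b * (1 - ?m)"
    using pos_functional_one b by (intro mult_left_mono) auto
  finally show ?thesis using up lo by linarith
qed

end


section \<open>Compensation of operators\<close>

text \<open>The weak-star topology is pulled back from a product of lines, so continuity is tested
  one coordinate at a time; compactness makes every continuous function one of the indices. From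
  here on no topology on measures appears.\<close>

lemma weak_star_maps_iff:
  fixes F :: "'k::t2_space \<Rightarrow> 'k set \<Rightarrow> real"
  assumes K: "compact (UNIV :: 'k set)"
  shows "F \<in> weak_star_maps \<longleftrightarrow> (\<forall>t. F t \<in> signed_measures_ball) \<and>
    (\<forall>f. continuous_on UNIV f \<longrightarrow> continuous_on UNIV (\<lambda>t. signed_integral (F t) f))"
    (is "_ \<longleftrightarrow> ?ball \<and> ?cont")
proof -
  let ?e = "\<lambda>\<mu> (f :: 'k \<Rightarrow>\<^sub>C real). signed_integral \<mu> (apply_bcontfun f)"
  let ?P = "product_topology (\<lambda>_ :: 'k \<Rightarrow>\<^sub>C real. euclideanreal) UNIV"
  have "F \<in> weak_star_maps \<longleftrightarrow> ?ball \<and> continuous_map euclidean weak_star_topology F"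
    by (auto simp: weak_star_maps_def continuous_map_in_subtopology)
  moreover have "continuous_map euclidean weak_star_topology F
      \<longleftrightarrow> continuous_map euclidean ?P (?e \<circ> F)" if ball: ?ball
  proof
    assume "continuous_map euclidean weak_star_topology F"
    moreover have "continuous_map weak_star_topology ?P (id \<circ> ?e)"
      unfolding weak_star_topology_def by (rule continuous_map_pullback) simp
    ultimately show "continuous_map euclidean ?P (?e \<circ> F)"
      using continuous_map_compose by fastforce
  next
    assume "continuous_map euclidean ?P (?e \<circ> F)"
    then show "continuous_map euclidean weak_star_topology F"
      unfolding weak_star_topology_def
      using ball by (intro continuous_map_pullback') (auto simp: signed_measures_ball_def)
  qed
  moreover have "continuous_map euclidean ?P (?e \<circ> F) \<longleftrightarrow> ?cont"
  proof -
    have "continuous_map euclidean ?P (?e \<circ> F) \<longleftrightarrow>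
        (\<forall>f. continuous_on UNIV (\<lambda>t. signed_integral (F t) (apply_bcontfun f)))"
      by (simp add: continuous_map_componentwise_UNIV o_def)
    also have "\<dots> \<longleftrightarrow> ?cont"
    proof
      assume *: "\<forall>f. continuous_on UNIV (\<lambda>t. signed_integral (F t) (apply_bcontfun f))"
      show ?cont
      proof (intro allI impI)
        fix f :: "'k \<Rightarrow> real" assume f: "continuous_on UNIV f"
        then have "f \<in> bcontfun"
          using K compact_continuous_image compact_imp_bounded by (auto simp: bcontfun_def)
        then show "continuous_on UNIV (\<lambda>t. signed_integral (F t) f)"
          using * Bcontfun_inverse by metis
      qed
    qed auto
    finally show ?thesis .
  qed
  ultimately show ?thesis by blast
qed

definition contractive_operator :: "(('k::t2_space \<Rightarrow> real) \<Rightarrow> 'k \<Rightarrow> real) \<Rightarrow> bool" where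
  "contractive_operator T \<longleftrightarrow>
     (\<forall>t. contractive_functional (\<lambda>f. T f t)) \<and> (\<forall>f. continuous_on UNIV f \<longrightarrow> continuous_on UNIV (T f))"

lemma contractive_operatorD:
  assumes "contractive_operator T"
  shows "contractive_functional (\<lambda>f. T f t)" "continuous_on UNIV f \<Longrightarrow> continuous_on UNIV (T f)"
  using assms by (auto simp: contractive_operator_def)

text \<open>This hides the measures: \<open>J f t\<close> integrates \<open>f\<close> against a
  compensation of the measure representing \<open>H\<close> at \<open>t\<close>. The bound by the
  positive part of \<open>H\<close> is phrased through minorants so that it can be used for
  functionals alone. Linearity and positivity hold at every \<open>t\<close>, as the compensation is
  zero where \<open>H 1\<close> is not positive.\<close>

lemma operator_compensation:
  fixes H :: "('k::t2_space \<Rightarrow> real) \<Rightarrow> 'k \<Rightarrow> real"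
  assumes lc: "admits_local_compensation TYPE('k)" and H: "contractive_operator H"
  obtains J :: "('k \<Rightarrow> real) \<Rightarrow> 'k \<Rightarrow> real" where
    "\<And>f. continuous_on UNIV f \<Longrightarrow> continuous_on UNIV (J f)"
    "\<And>f g t. \<lbrakk>continuous_on UNIV f; continuous_on UNIV g\<rbrakk> \<Longrightarrow> J (\<lambda>x. f x + g x) t = J f t + J g t"
    "\<And>f a t. continuous_on UNIV f \<Longrightarrow> J (\<lambda>x. a * f x) t = a * J f t"
    "\<And>f t. \<lbrakk>continuous_on UNIV f; \<And>x. 0 \<le> f x\<rbrakk> \<Longrightarrow> 0 \<le> J f t"
    "\<And>t. 0 < H (\<lambda>_. 1) t \<Longrightarrow> J (\<lambda>_. 1) t = H (\<lambda>_. 1) t"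
    "\<And>f c t. \<lbrakk>0 < H (\<lambda>_. 1) t; continuous_on UNIV f; \<And>x. 0 \<le> f x;
        \<And>g. \<lbrakk>continuous_on UNIV g; \<And>x. 0 \<le> g x; \<And>x. g x \<le> f x\<rbrakk> \<Longrightarrow> H g t \<le> c\<rbrakk> \<Longrightarrow> J f t \<le> c"
    "\<And>f b t. \<lbrakk>0 < H (\<lambda>_. 1) t; continuous_on UNIV f; \<And>x. \<bar>f x\<bar> \<le> b\<rbrakk>
        \<Longrightarrow> \<bar>H f t - J f t\<bar> \<le> b * (1 - H (\<lambda>_. 1) t)"
proof -
  interpret H: contractive_functional "\<lambda>f. H f t" for t
    by (rule contractive_operatorD(1)[OF H])
  have K: "compact (UNIV :: 'k set)" by (rule H.compact)
  have rep: "(\<lambda>t. H.representing_measure t) \<in> weak_star_maps"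
    unfolding weak_star_maps_iff[OF K]
    using contractive_operatorD(2)[OF H]
    by (simp add: H.representing_measure_ball H.signed_integral_representing)
  obtain G :: "'k \<Rightarrow> 'k set \<Rightarrow> real" where G: "G \<in> weak_star_maps"
    and comp: "\<And>t. is_compensation (G t) (H.representing_measure t)"
    using lc[unfolded admits_local_compensation_def, THEN bspec, OF rep] by blast
  let ?J = "\<lambda>f t. signed_integral (G t) f"
  show ?thesis
  proof (rule that[of ?J])
    show "continuous_on UNIV (\<lambda>t. signed_integral (G t) f)" if "continuous_on UNIV f" for f
      using G that unfolding weak_star_maps_iff[OF K] by blast
    show "signed_integral (G t) (\<lambda>x. f x + g x) = signed_integral (G t) f + signed_integral (G t) g"
      if f: "continuous_on UNIV f" and g: "continuous_on UNIV g" for f g t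
    \<comment> \<open>Where \<open>H 1\<close> is not positive the compensation is the zero measure
      and both sides are 0.\<close>
    proof (cases "0 < H (\<lambda>_. 1) t")
      case False
      then show ?thesis using f g H.compensation_nonpos[OF comp, of t] by (simp add: continuous_on_add)
    qed (rule H.compensation_pos(1)[OF comp _ f g])
    show "signed_integral (G t) (\<lambda>x. a * f x) = a * signed_integral (G t) f"
      if f: "continuous_on UNIV f" for f a t
    proof (cases "0 < H (\<lambda>_. 1) t")
      case False
      then show ?thesis using f H.compensation_nonpos[OF comp, of t] by (simp add: continuous_on_mult_left)
    qed (rule H.compensation_pos(2)[OF comp _ f])
    show "0 \<le> signed_integral (G t) f" if f: "continuous_on UNIV f" "\<And>x. 0 \<le> f x" for f t
    proof (cases "0 < H (\<lambda>_. 1) t")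
      case False
      then show ?thesis using f H.compensation_nonpos[OF comp, of t] by simp
    qed (rule H.compensation_pos(3)[OF comp _ f])
    show "signed_integral (G t) (\<lambda>_. 1) = H (\<lambda>_. 1) t" if "0 < H (\<lambda>_. 1) t" for t
      by (rule H.compensation_pos(5)[OF comp that])
    show "signed_integral (G t) f \<le> c"
      if "0 < H (\<lambda>_. 1) t" and f: "continuous_on UNIV f" "\<And>x. 0 \<le> f x"
        and c: "\<And>g. \<lbrakk>continuous_on UNIV g; \<And>x. 0 \<le> g x; \<And>x. g x \<le> f x\<rbrakk> \<Longrightarrow> H g t \<le> c" for f c t
    proof -
      have "signed_integral (G t) f \<le> H.pos_functional t f"
        by (rule H.compensation_pos(4)[OF comp that(1) f])
      also have "\<dots> \<le> c"
        by (rule H.pos_functional_least) (use f c in \<open>auto simp: H.minorants_def\<close>)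
      finally show ?thesis .
    qed
    show "\<bar>H f t - signed_integral (G t) f\<bar> \<le> b * (1 - H (\<lambda>_. 1) t)"
      if "0 < H (\<lambda>_. 1) t" "continuous_on UNIV f" "\<And>x. \<bar>f x\<bar> \<le> b" for f b t
      by (rule H.compensation_close[OF comp that])
  qed
qed

lemma contractive_operator_weight:
  assumes T: "contractive_operator T" and s: "continuous_on UNIV s" "\<And>t. \<bar>s t\<bar> \<le> 1"
    and q: "continuous_on UNIV q" "\<And>t. \<bar>q t\<bar> \<le> 1"
  shows "contractive_operator (\<lambda>f t. s t * T (\<lambda>x. q x * f x) t)"
  unfolding contractive_operator_def
proof (intro conjI allI impI)
  fix t
  interpret T: contractive_functional "\<lambda>f. T f t" by (rule contractive_operatorD(1)[OF T])
  show "contractive_functional (\<lambda>f. s t * T (\<lambda>x. q x * f x) t)"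
  proof
    fix f g :: "'a \<Rightarrow> real" assume f: "continuous_on UNIV f" and g: "continuous_on UNIV g"
    have "T (\<lambda>x. q x * f x + q x * g x) t = T (\<lambda>x. q x * f x) t + T (\<lambda>x. q x * g x) t"
      by (intro T.add continuous_intros q f g)
    then show "s t * T (\<lambda>x. q x * (f x + g x)) t = s t * T (\<lambda>x. q x * f x) t + s t * T (\<lambda>x. q x * g x) t"
      by (simp add: distrib_left)
  next
    fix f :: "'a \<Rightarrow> real" and a assume f: "continuous_on UNIV f"
    have "T (\<lambda>x. a * (q x * f x)) t = a * T (\<lambda>x. q x * f x) t"
      by (intro T.scale continuous_intros q f)
    then show "s t * T (\<lambda>x. q x * (a * f x)) t = a * (s t * T (\<lambda>x. q x * f x) t)"
      by (simp add: mult.left_commute)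
  next
    fix f :: "'a \<Rightarrow> real" and b assume f: "continuous_on UNIV f" "\<And>x. \<bar>f x\<bar> \<le> b"
    have "\<bar>q x * f x\<bar> \<le> b" for x
      using mult_mono[OF q(2)[of x] f(2)[of x]] by (simp add: abs_mult)
    then have "\<bar>T (\<lambda>x. q x * f x) t\<bar> \<le> b"
      by (intro T.bound continuous_intros q f)
    then show "\<bar>s t * T (\<lambda>x. q x * f x) t\<bar> \<le> b"
      using mult_mono[OF s(2)[of t], of "\<bar>T (\<lambda>x. q x * f x) t\<bar>" b] by (simp add: abs_mult)
  qed (rule T.compact)
next
  fix f :: "'a \<Rightarrow> real" assume "continuous_on UNIV f"
  then show "continuous_on UNIV (\<lambda>t. s t * T (\<lambda>x. q x * f x) t)"
    by (intro continuous_intros s contractive_operatorD(2)[OF T] q)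
qed

text \<open>Where \<open>\<bar>T q t\<bar>\<close> is close to 1, the measure of \<open>f \<mapsto> T f t\<close> is replaced by \<open>x0\<close> times a
  normalised compensation of the measure of \<open>f \<mapsto> sgn (T q t) * T (q f) t\<close>. The latter measure lives
  on \<open>{q \<noteq> 0}\<close>, where \<open>x0\<^sup>2 = 1\<close>.\<close>

lemma operator_perturbation:
  fixes T :: "('k::t2_space \<Rightarrow> real) \<Rightarrow> 'k \<Rightarrow> real"
  assumes lc: "admits_local_compensation TYPE('k)" and T: "contractive_operator T"
    and q: "continuous_on UNIV q" "\<And>x. \<bar>q x\<bar> \<le> 1"
    and x0: "continuous_on UNIV x0" "\<And>x. \<bar>x0 x\<bar> \<le> 1" "\<And>x. q x * x0 x = \<bar>q x\<bar>"
    and \<beta>: "0 < \<beta>" "\<beta> \<le> 1 / 4"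
  obtains S where "contractive_operator S"
    "\<And>f b t. \<lbrakk>continuous_on UNIV f; \<And>x. \<bar>f x\<bar> \<le> b\<rbrakk> \<Longrightarrow> \<bar>T f t - S f t\<bar> \<le> 6 * \<beta> * b"
    "\<And>t. 1 - \<beta> \<le> \<bar>T q t\<bar> \<Longrightarrow> S x0 t = sgn (T q t)"
proof -
  interpret T: contractive_functional "\<lambda>f. T f t" for t
    by (rule contractive_operatorD(1)[OF T])
  note contT = contractive_operatorD(2)[OF T]
  define m where "m = T q"
  \<comment> \<open>A continuous substitute for \<open>sgn (m t)\<close>, equal to it as soon as
    \<open>\<bar>m t\<bar> \<ge> 1/2\<close>.\<close>
  define s where "s t = max (-1) (min 1 (2 * m t))" for t
  \<comment> \<open>A cutoff: 0 where \<open>\<bar>m t\<bar> \<le> 1 - 2 \<beta>\<close> and 1 where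
    \<open>\<bar>m t\<bar> \<ge> 1 - \<beta>\<close>. It blends the compensated functional into the
    original one.\<close>
  define \<theta> where "\<theta> t = max 0 (min 1 ((\<bar>m t\<bar> - (1 - 2 * \<beta>)) / \<beta>))" for t
  \<comment> \<open>The factor that normalises \<open>J\<close> and restores the sign. The lower
    bound 1/2 keeps the quotient continuous and is inactive where \<theta> is nonzero, because
    \<open>1 - 2 \<beta> \<ge> 1/2\<close>.\<close>
  define c where "c t = \<theta> t * s t / max \<bar>m t\<bar> (1 / 2)" for t
  define H where "H f t = s t * T (\<lambda>x. q x * f x) t" for f t
  have contm: "continuous_on UNIV m" unfolding m_def by (rule contT[OF q(1)])
  have conts: "continuous_on UNIV s" unfolding s_def by (intro continuous_intros contm)
  have cont\<theta>: "continuous_on UNIV \<theta>" unfolding \<theta>_def using \<beta> by (intro continuous_intros contm) auto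
  have contc: "continuous_on UNIV c" unfolding c_def
    by (intro continuous_intros contm conts cont\<theta>) (auto simp: max_def)
  have m1: "\<bar>m t\<bar> \<le> 1" for t unfolding m_def by (rule T.bound[OF q])
  have "contractive_operator H"
    unfolding H_def by (rule contractive_operator_weight[OF T conts _ q]) (auto simp: s_def)
  then obtain J :: "('k \<Rightarrow> real) \<Rightarrow> 'k \<Rightarrow> real" where contJ:
    "\<And>f. continuous_on UNIV f \<Longrightarrow> continuous_on UNIV (J f)"
    and J_add: "\<And>f g t. \<lbrakk>continuous_on UNIV f; continuous_on UNIV g\<rbrakk> \<Longrightarrow> J (\<lambda>x. f x + g x) t = J f t + J g t"
    and J_scale: "\<And>f a t. continuous_on UNIV f \<Longrightarrow> J (\<lambda>x. a * f x) t = a * J f t"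
    and J_nonneg: "\<And>f t. \<lbrakk>continuous_on UNIV f; \<And>x. 0 \<le> f x\<rbrakk> \<Longrightarrow> 0 \<le> J f t"
    and J_one: "\<And>t. 0 < H (\<lambda>_. 1) t \<Longrightarrow> J (\<lambda>_. 1) t = H (\<lambda>_. 1) t"
    and J_le: "\<And>f c t. \<lbrakk>0 < H (\<lambda>_. 1) t; continuous_on UNIV f; \<And>x. 0 \<le> f x;
        \<And>g. \<lbrakk>continuous_on UNIV g; \<And>x. 0 \<le> g x; \<And>x. g x \<le> f x\<rbrakk> \<Longrightarrow> H g t \<le> c\<rbrakk> \<Longrightarrow> J f t \<le> c"
    and J_close: "\<And>f b t. \<lbrakk>0 < H (\<lambda>_. 1) t; continuous_on UNIV f; \<And>x. \<bar>f x\<bar> \<le> b\<rbrakk>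
        \<Longrightarrow> \<bar>H f t - J f t\<bar> \<le> b * (1 - H (\<lambda>_. 1) t)"
    using operator_compensation[OF lc] by blast
  have active: "\<bar>m t\<bar> > 1 - 2 * \<beta>" "s t = sgn (m t)" "\<bar>s t\<bar> = 1" "H (\<lambda>_. 1) t = \<bar>m t\<bar>"
    "c t = \<theta> t * (s t / \<bar>m t\<bar>)" "0 < \<bar>m t\<bar>" "J (\<lambda>_. 1) t = \<bar>m t\<bar>" if "\<theta> t \<noteq> 0" for t
  proof -
    have "0 < (\<bar>m t\<bar> - (1 - 2 * \<beta>)) / \<beta>" using that unfolding \<theta>_def by linarith
    then show big: "\<bar>m t\<bar> > 1 - 2 * \<beta>" using \<beta> by (simp add: zero_less_divide_iff)
    then have half: "\<bar>m t\<bar> \<ge> 1 / 2" using \<beta> by linarith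
    then show pos: "0 < \<bar>m t\<bar>" by linarith
    show s: "s t = sgn (m t)" using half by (auto simp: s_def sgn_if abs_if split: if_splits)
    show "\<bar>s t\<bar> = 1" using s pos by (simp add: abs_sgn_eq)
    show h: "H (\<lambda>_. 1) t = \<bar>m t\<bar>"
      unfolding H_def s using mult_sgn_abs[of "m t"] by (simp add: m_def abs_sgn mult.commute)
    show "c t = \<theta> t * (s t / \<bar>m t\<bar>)" using half by (simp add: c_def max_def)
    show "J (\<lambda>_. 1) t = \<bar>m t\<bar>" using J_one[of t] h pos by simp
  qed
  have \<theta>01: "0 \<le> \<theta> t" "\<theta> t \<le> 1" for t by (auto simp: \<theta>_def)
  have J_bound: "\<bar>J f t\<bar> \<le> b * J (\<lambda>_. 1) t" if f: "continuous_on UNIV f" "\<And>x. \<bar>f x\<bar> \<le> b" for f b t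
  proof -
    have "0 \<le> b + f x" "0 \<le> b + (-1) * f x" for x using f(2)[of x] by auto
    then have "0 \<le> J (\<lambda>x. b + f x) t" "0 \<le> J (\<lambda>x. b + (-1) * f x) t"
      by (intro J_nonneg continuous_intros f; blast)+
    moreover have "J (\<lambda>_. b) t = b * J (\<lambda>_. 1) t"
      using J_scale[of "\<lambda>_. 1" b t] by simp
    ultimately show ?thesis
      using J_add[of "\<lambda>_. b" f t] J_add[of "\<lambda>_. b" "\<lambda>x. (-1) * f x" t] J_scale[OF f(1), of "-1" t] f(1)
      by (simp add: continuous_intros)
  qed
  \<comment> \<open>Where \<theta> is nonzero, \<open>J\<close> has mass
    \<open>\<bar>m t\<bar>\<close>, so division by it leaves norm at most one and \<open>S\<close>
    is pointwise a convex combination of contractions.\<close>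
  define S where "S f t = (1 - \<theta> t) * T f t + c t * J (\<lambda>x. x0 x * f x) t" for f t
  have x0f: "continuous_on UNIV (\<lambda>x. x0 x * f x)" if "continuous_on UNIV f" for f
    by (intro continuous_intros x0 that)
  have x0fb: "\<bar>x0 x * f x\<bar> \<le> b" if "\<And>x. \<bar>f x\<bar> \<le> b" for f b x
    using mult_mono[OF x0(2)[of x] that[of x]] by (simp add: abs_mult)
  have Jx0: "\<bar>J (\<lambda>x. x0 x * f x) t\<bar> \<le> b * J (\<lambda>_. 1) t"
    if f: "continuous_on UNIV f" "\<And>x. \<bar>f x\<bar> \<le> b" for f b t
    by (rule J_bound) (use x0f[OF f(1)] x0fb f(2) in auto)
  have cJ: "\<bar>c t * J (\<lambda>x. x0 x * f x) t\<bar> \<le> \<theta> t * b"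
    if f: "continuous_on UNIV f" "\<And>x. \<bar>f x\<bar> \<le> b" for f b t
  proof (cases "\<theta> t = 0")
    case False
    note a = active[OF this]
    have "\<bar>c t * J (\<lambda>x. x0 x * f x) t\<bar> = \<theta> t * (\<bar>J (\<lambda>x. x0 x * f x) t\<bar> / \<bar>m t\<bar>)"
      using a \<theta>01[of t] by (simp add: abs_mult)
    also have "\<bar>J (\<lambda>x. x0 x * f x) t\<bar> \<le> b * \<bar>m t\<bar>"
      using Jx0[OF f, of t] a(7) by simp
    then have "\<theta> t * (\<bar>J (\<lambda>x. x0 x * f x) t\<bar> / \<bar>m t\<bar>) \<le> \<theta> t * b"
      using a(6) \<theta>01[of t] by (intro mult_left_mono) (auto simp: field_simps)
    finally show ?thesis .
  qed (simp add: c_def)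
  show ?thesis
  proof (rule that[of S])
    show "contractive_operator S"
      unfolding contractive_operator_def
    proof (intro conjI allI impI)
      show "continuous_on UNIV (S f)" if "continuous_on UNIV f" for f
        unfolding S_def by (intro continuous_intros cont\<theta> contc contT contJ x0f that)
    next
      fix t
      show "contractive_functional (\<lambda>f. S f t)"
      proof
        show "compact (UNIV :: 'k set)" by (rule T.compact)
      next
        fix f g :: "'k \<Rightarrow> real" assume f: "continuous_on UNIV f" and g: "continuous_on UNIV g"
        have "J (\<lambda>x. x0 x * (f x + g x)) t = J (\<lambda>x. x0 x * f x) t + J (\<lambda>x. x0 x * g x) t"
          using J_add[OF x0f[OF f] x0f[OF g]] by (simp add: distrib_left)
        then show "S (\<lambda>x. f x + g x) t = S f t + S g t"
          unfolding S_def using T.add[OF f g] by (simp add: algebra_simps)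
      next
        fix f :: "'k \<Rightarrow> real" and a assume f: "continuous_on UNIV f"
        have "J (\<lambda>x. x0 x * (a * f x)) t = a * J (\<lambda>x. x0 x * f x) t"
          using J_scale[OF x0f[OF f]] by (simp add: mult.left_commute)
        then show "S (\<lambda>x. a * f x) t = a * S f t"
          unfolding S_def using T.scale[OF f] by (simp add: algebra_simps)
      next
        fix f :: "'k \<Rightarrow> real" and b assume f: "continuous_on UNIV f" "\<And>x. \<bar>f x\<bar> \<le> b"
        have "\<bar>S f t\<bar> \<le> (1 - \<theta> t) * \<bar>T f t\<bar> + \<bar>c t * J (\<lambda>x. x0 x * f x) t\<bar>"
          unfolding S_def using \<theta>01[of t] by (intro order_trans[OF abs_triangle_ineq]) (simp add: abs_mult)
        also have "\<dots> \<le> (1 - \<theta> t) * b + \<theta> t * b"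
          using \<theta>01[of t] by (intro add_mono mult_left_mono cJ f T.bound) auto
        finally show "\<bar>S f t\<bar> \<le> b" by (simp add: algebra_simps)
      qed
    qed
  next
    fix f :: "'k \<Rightarrow> real" and b t assume f: "continuous_on UNIV f" "\<And>x. \<bar>f x\<bar> \<le> b"
    have b: "0 \<le> b" using f(2)[of undefined] by simp
    show "\<bar>T f t - S f t\<bar> \<le> 6 * \<beta> * b"
    proof (cases "\<theta> t = 0")
      case True
      then show ?thesis using b \<beta> by (simp add: S_def c_def)
    next
      case False
      note a = active[OF this]
      let ?j = "J (\<lambda>x. x0 x * f x) t" and ?r = "\<lambda>x. (1 - \<bar>q x\<bar>) * f x"
      have s2: "s t * s t = 1" using a(3) by (metis abs_mult_self_eq mult_1)
      have contr: "continuous_on UNIV ?r" by (intro continuous_intros q f)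
      have rb: "\<bar>?r x\<bar> + b * \<bar>q x\<bar> \<le> b" for x
      proof -
        have "\<bar>?r x\<bar> \<le> (1 - \<bar>q x\<bar>) * b"
          using q(2)[of x] f(2)[of x] by (simp add: abs_mult mult_left_mono)
        then show ?thesis by (simp add: algebra_simps)
      qed
      \<comment> \<open>Since \<open>?r + e b q\<close> is bounded by \<open>b\<close> for both
        signs \<open>e\<close>, the value at \<open>?r\<close> leaves room for
        \<open>b * \<bar>m t\<bar>\<close>; one takes the sign that adds up.\<close>
      have r: "\<bar>T ?r t\<bar> \<le> b * (1 - \<bar>m t\<bar>)"
      proof -
        have "\<bar>T ?r t + e * (b * m t)\<bar> \<le> b" if "\<bar>e\<bar> = 1" for e :: real
        proof -
          have "\<bar>T (\<lambda>x. ?r x + (e * b) * q x) t\<bar> \<le> b"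
          proof (rule T.bound)
            show "continuous_on UNIV (\<lambda>x. ?r x + (e * b) * q x)" by (intro continuous_intros contr q)
            show "\<bar>?r x + (e * b) * q x\<bar> \<le> b" for x
              using rb[of x] that b abs_triangle_ineq[of "?r x" "(e * b) * q x"]
              by (simp add: abs_mult)
          qed
          moreover have "T (\<lambda>x. ?r x + (e * b) * q x) t = T ?r t + (e * b) * m t"
            using contr q by (simp add: T.add T.scale m_def continuous_intros)
          ultimately show ?thesis by (simp add: mult.assoc)
        qed
        from this[of 1] this[of "-1"] show ?thesis
          by (cases "0 \<le> m t") (auto simp: abs_if algebra_simps split: if_splits)
      qed
      \<comment> \<open>\<open>f = (1 - \<bar>q\<bar>) f + q (x0 f)\<close> because
        \<open>q x0 = \<bar>q\<bar>\<close>; only the second part passes through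
        \<open>H\<close>.\<close>
      have "T f t = T ?r t + T (\<lambda>x. q x * (x0 x * f x)) t"
      proof -
        have "(\<lambda>x. ?r x + q x * (x0 x * f x)) = f"
        proof
          fix x
          show "?r x + q x * (x0 x * f x) = f x"
            using x0(3)[of x] by (simp add: mult.assoc[symmetric] left_diff_distrib)
        qed
        moreover have "T (\<lambda>x. ?r x + q x * (x0 x * f x)) t = T ?r t + T (\<lambda>x. q x * (x0 x * f x)) t"
          by (intro T.add contr continuous_intros q x0f f)
        ultimately show ?thesis by simp
      qed
      also have "T (\<lambda>x. q x * (x0 x * f x)) t = s t * H (\<lambda>x. x0 x * f x) t"
        unfolding H_def by (simp add: mult.assoc[symmetric] s2)
      \<comment> \<open>Three errors: the part of \<open>f\<close> that \<open>q\<close> misses, the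
        compensation, and the normalisation. Each is at most
        \<open>b (1 - \<bar>m t\<bar>) \<le> 2 \<beta> b\<close>, whence the constant
        \<open>6 \<beta>\<close>.\<close>
      finally have Tf: "T f t - s t / \<bar>m t\<bar> * ?j =
          T ?r t + s t * (H (\<lambda>x. x0 x * f x) t - ?j) + s t * (?j * (1 - 1 / \<bar>m t\<bar>))"
        by (simp add: algebra_simps)
      have "\<bar>s t * (H (\<lambda>x. x0 x * f x) t - ?j)\<bar> \<le> b * (1 - \<bar>m t\<bar>)"
      proof -
        have "\<bar>H (\<lambda>x. x0 x * f x) t - ?j\<bar> \<le> b * (1 - H (\<lambda>_. 1) t)"
          by (rule J_close) (use a x0f[OF f(1)] x0fb f(2) in auto)
        then show ?thesis using a by (simp add: abs_mult)
      qed
      moreover have "\<bar>s t * (?j * (1 - 1 / \<bar>m t\<bar>))\<bar> \<le> b * (1 - \<bar>m t\<bar>)"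
      proof -
        have "\<bar>s t * (?j * (1 - 1 / \<bar>m t\<bar>))\<bar> = \<bar>?j\<bar> * (1 / \<bar>m t\<bar> - 1)"
        proof -
          have "1 \<le> 1 / \<bar>m t\<bar>" using a(6) m1[of t] by (simp add: le_divide_eq)
          then have "\<bar>1 - 1 / \<bar>m t\<bar>\<bar> = 1 / \<bar>m t\<bar> - 1" by linarith
          then show ?thesis using a(3) by (simp only: abs_mult mult_1)
        qed
        also have "\<dots> \<le> (b * \<bar>m t\<bar>) * (1 / \<bar>m t\<bar> - 1)"
          using Jx0[OF f, of t] a m1[of t]
          by (intro mult_right_mono) auto
        also have "\<dots> = b * (1 - \<bar>m t\<bar>)" using a(6) by (simp add: field_simps)
        finally show ?thesis .
      qed
      ultimately have "\<bar>T f t - s t / \<bar>m t\<bar> * ?j\<bar> \<le> 3 * (b * (1 - \<bar>m t\<bar>))"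
        unfolding Tf using r by linarith
      also have "\<dots> \<le> 3 * (b * (2 * \<beta>))"
        using a(1) b by (intro mult_left_mono) auto
      finally have main: "\<bar>T f t - s t / \<bar>m t\<bar> * ?j\<bar> \<le> 6 * \<beta> * b" by (simp add: mult_ac)
      have "T f t - S f t = \<theta> t * (T f t - s t / \<bar>m t\<bar> * ?j)"
        unfolding S_def a(5) by (simp add: algebra_simps)
      then have "\<bar>T f t - S f t\<bar> \<le> 1 * \<bar>T f t - s t / \<bar>m t\<bar> * ?j\<bar>"
        using \<theta>01[of t] by (simp only: abs_mult) (intro mult_right_mono, auto)
      then show ?thesis using main by simp
    qed
  next
    fix t assume mt: "1 - \<beta> \<le> \<bar>T q t\<bar>"
    have "1 \<le> (\<bar>m t\<bar> - (1 - 2 * \<beta>)) / \<beta>" using mt \<beta> by (simp add: m_def field_simps)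
    then have \<theta>: "\<theta> t = 1" by (simp add: \<theta>_def)
    then have "\<theta> t \<noteq> 0" by simp
    note a = active[OF this]
    have sq: "x0 x * x0 x \<le> 1" for x
      using mult_mono[OF x0(2)[of x] x0(2)[of x]] by (simp add: abs_mult_self_eq flip: abs_mult)
    let ?z = "\<lambda>x. 1 - x0 x * x0 x"
    have contz: "continuous_on UNIV ?z" by (intro continuous_intros x0)
    \<comment> \<open>A nonnegative minorant of \<open>1 - x0^2\<close> vanishes wherever
      \<open>q\<close> does not, as \<open>\<bar>x0\<bar> = 1\<close> there. Hence \<open>H\<close>,
      which inserts the factor \<open>q\<close>, annihilates it, and the bound by minorants passes
      to \<open>J\<close>.\<close>
    have "J ?z t \<le> 0"
    proof (rule J_le)
      show "0 < H (\<lambda>_. 1) t" using a by simp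
      fix g assume g: "continuous_on UNIV g" "\<And>x. 0 \<le> g x" "\<And>x. g x \<le> ?z x"
      have "q x * g x = 0" for x
      proof (cases "q x = 0")
        case False
        have "\<bar>q x\<bar> * \<bar>x0 x\<bar> = \<bar>q x\<bar>" using x0(3)[of x] by (metis abs_idempotent abs_mult)
        then have "\<bar>x0 x\<bar> = 1" using False by simp
        then have "x0 x * x0 x = 1" by (metis abs_mult_self_eq mult_1)
        then show ?thesis using g(2,3)[of x] by simp
      qed simp
      then have "(\<lambda>x. q x * g x) = (\<lambda>x. 0 * g x)" by (intro ext) simp
      then have "H g t = s t * T (\<lambda>x. 0 * g x) t" unfolding H_def by (rule arg_cong)
      also have "\<dots> = 0" using T.scale[OF g(1), of 0 t] by simp
      finally show "H g t \<le> 0" by simp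
    qed (use sq contz in auto)
    moreover have "0 \<le> J ?z t" using sq by (intro J_nonneg contz) auto
    moreover have "J (\<lambda>x. ?z x + x0 x * x0 x) t = J ?z t + J (\<lambda>x. x0 x * x0 x) t"
      by (intro J_add contz x0f x0)
    ultimately have "J (\<lambda>x. x0 x * x0 x) t = \<bar>m t\<bar>" using a(7) by simp
    then have "S x0 t = s t" unfolding S_def a(5) using \<theta> a(6) by simp
    then show "S x0 t = sgn (T q t)" using a(2) by (simp add: m_def)
  qed
qed


section \<open>Localising a norm-attaining functional\<close>

locale attaining_functional = contractive_functional \<psi>
  for \<psi> :: "('k::t2_space \<Rightarrow> real) \<Rightarrow> real" +
  fixes x :: "'k \<Rightarrow> real"
  assumes cont_x: "continuous_on UNIV x" and abs_x: "\<And>t. \<bar>x t\<bar> \<le> 1" and attains: "\<psi> x = 1"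
begin

text \<open>Attainment at \<open>x\<close> acts as a polar decomposition. For
  \<open>\<bar>g\<bar> \<le> b\<close> the mixture \<open>w g + (1 - w) b x\<close> is still bounded
  by \<open>b\<close>, and its value is \<open>\<psi> (w g) + b (1 - \<psi> (w x))\<close>;
  rearranging gives the estimate.\<close>

lemma dominated_by_weight:
  assumes w: "continuous_on UNIV w" "\<And>t. 0 \<le> w t" "\<And>t. w t \<le> 1"
    and f: "continuous_on UNIV f" "\<And>t. \<bar>f t\<bar> \<le> b"
  shows "\<bar>\<psi> (\<lambda>t. w t * f t)\<bar> \<le> b * \<psi> (\<lambda>t. w t * x t)"
proof -
  have b: "0 \<le> b" using f(2)[of undefined] by simp
  have one: "\<psi> (\<lambda>t. w t * g t) \<le> b * \<psi> (\<lambda>t. w t * x t)"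
    if g: "continuous_on UNIV g" "\<And>t. \<bar>g t\<bar> \<le> b" for g
  proof -
    have cg: "continuous_on UNIV (\<lambda>t. w t * g t)" and cx: "continuous_on UNIV (\<lambda>t. w t * x t)"
      and cbx: "continuous_on UNIV (\<lambda>t. b * (x t - w t * x t))"
      and cxx: "continuous_on UNIV (\<lambda>t. x t - w t * x t)"
      by (intro continuous_intros w g cont_x)+
    have "\<bar>\<psi> (\<lambda>t. w t * g t + b * (x t - w t * x t))\<bar> \<le> b"
    proof (rule bound)
      show "continuous_on UNIV (\<lambda>t. w t * g t + b * (x t - w t * x t))"
        by (intro continuous_on_add cg cbx)
      show "\<bar>w t * g t + b * (x t - w t * x t)\<bar> \<le> b" for t
      proof -
        have "w t * g t + b * (x t - w t * x t) = w t * g t + (1 - w t) * (b * x t)"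
          by (simp add: algebra_simps)
        also have "\<bar>\<dots>\<bar> \<le> w t * \<bar>g t\<bar> + (1 - w t) * (b * \<bar>x t\<bar>)"
          using w(2,3)[of t] b by (intro order_trans[OF abs_triangle_ineq]) (simp add: abs_mult)
        also have "\<dots> \<le> w t * b + (1 - w t) * (b * 1)"
          using w(2,3)[of t] b g(2)[of t] abs_x[of t] by (intro add_mono mult_left_mono) auto
        finally show ?thesis by (simp add: algebra_simps)
      qed
    qed
    moreover have "\<psi> (\<lambda>t. w t * g t + b * (x t - w t * x t))
        = \<psi> (\<lambda>t. w t * g t) + b * (1 - \<psi> (\<lambda>t. w t * x t))"
      by (simp add: add[OF cg cbx] scale[OF cxx] sub[OF cont_x cx] attains)
    ultimately show ?thesis by (simp add: algebra_simps)
  qed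
  have "continuous_on UNIV (\<lambda>t. w t * f t)" by (intro continuous_intros w f)
  then have "\<psi> (\<lambda>t. w t * ((-1) * f t)) = - \<psi> (\<lambda>t. w t * f t)"
    using scale[of "\<lambda>t. w t * f t" "-1"] by simp
  moreover have "\<psi> (\<lambda>t. w t * ((-1) * f t)) \<le> b * \<psi> (\<lambda>t. w t * x t)"
    by (rule one) (auto intro!: continuous_intros f)
  ultimately show ?thesis using one[OF f] by simp
qed

text \<open>Scale \<open>u\<close> down to a weight and let it dominate the zero function.\<close>

lemma weight_nonneg:
  assumes u: "continuous_on UNIV u" "\<And>t. 0 \<le> u t"
  shows "0 \<le> \<psi> (\<lambda>t. u t * x t)"
proof -
  obtain c where c: "0 < c" "\<And>t. \<bar>u t\<bar> \<le> c"
    using continuous_bounded_compact[OF compact u(1)] by blast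
  have "\<bar>\<psi> (\<lambda>t. (u t / c) * 0)\<bar> \<le> 1 * \<psi> (\<lambda>t. (u t / c) * x t)"
  proof (rule dominated_by_weight)
    show "u t / c \<le> 1" for t using c(1) c(2)[of t] by (simp add: abs_le_iff)
  qed (use u c in \<open>auto intro!: continuous_intros\<close>)
  also have "\<psi> (\<lambda>t. (u t / c) * x t) = \<psi> (\<lambda>t. (1 / c) * (u t * x t))" by simp
  also have "\<dots> = (1 / c) * \<psi> (\<lambda>t. u t * x t)"
    by (intro scale continuous_intros u cont_x)
  finally have "0 \<le> (1 / c) * \<psi> (\<lambda>t. u t * x t)" by linarith
  then show ?thesis using c(1) by (simp add: zero_le_divide_iff)
qed

text \<open>The polynomial \<open>(3 x - x^3) / 2\<close> maps [-1, 1] into itself, since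
  \<open>2 - 3 x + x^3 = (1 - x)^2 (2 + x)\<close> and symmetrically, so its value
  \<open>(3 - \<psi> (x^3)) / 2\<close> is at most 1. This replaces the measure-theoretic fact that
  \<open>x^2 = 1\<close> almost everywhere for the variation of \<psi>.\<close>

lemma cube_ge: "1 \<le> \<psi> (\<lambda>t. x t * x t * x t)"
proof -
  let ?c = "\<lambda>t. x t * x t * x t"
  have cc: "continuous_on UNIV ?c" by (intro continuous_intros cont_x)
  have ch: "continuous_on UNIV (\<lambda>t. (3/2) * x t)" "continuous_on UNIV (\<lambda>t. (1/2) * ?c t)"
    by (intro continuous_intros cont_x)+
  have "\<bar>\<psi> (\<lambda>t. (3/2) * x t - (1/2) * ?c t)\<bar> \<le> 1"
  proof (rule bound)
    show "continuous_on UNIV (\<lambda>t. (3/2) * x t - (1/2) * ?c t)" by (intro continuous_on_diff ch)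
    show "\<bar>(3/2) * x t - (1/2) * ?c t\<bar> \<le> 1" for t
    proof -
      have x: "-1 \<le> x t" "x t \<le> 1" using abs_x[of t] by auto
      have "0 \<le> (1 - x t) * (1 - x t) * (2 + x t)" using x by simp
      also have "\<dots> = 2 - 3 * x t + ?c t" by algebra
      finally have lo: "0 \<le> 2 - 3 * x t + ?c t" .
      have "0 \<le> (1 + x t) * (1 + x t) * (2 - x t)" using x by simp
      also have "\<dots> = 2 + 3 * x t - ?c t" by algebra
      finally have "0 \<le> 2 + 3 * x t - ?c t" .
      with lo show ?thesis by simp
    qed
  qed
  moreover have "\<psi> (\<lambda>t. (3/2) * x t - (1/2) * ?c t) = 3/2 - (1/2) * \<psi> ?c"
    using sub[OF ch] scale[OF cont_x, of "3/2"] scale[OF cc, of "1/2"] attains by simp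
  ultimately show ?thesis by simp
qed

text \<open>With the weight \<open>1 - x^2\<close>, the difference
  \<open>\<psi> y - \<psi> (x^2 y)\<close> is dominated by \<open>1 - \<psi> (x^3)\<close>, which
  \<open>cube_ge\<close> makes nonpositive.\<close>

lemma functional_le_weight:
  assumes y: "continuous_on UNIV y" "\<And>t. \<bar>y t\<bar> \<le> 1"
  shows "\<psi> y \<le> \<psi> (\<lambda>t. (x t * y t) * x t)"
proof -
  have x1: "0 \<le> x t * x t" "x t * x t \<le> 1" for t
    using mult_mono[OF abs_x[of t] abs_x[of t]] by (simp_all add: abs_mult_self_eq)
  have c: "continuous_on UNIV (\<lambda>t. x t * x t * x t)" "continuous_on UNIV (\<lambda>t. x t * y t * x t)"
    by (intro continuous_intros cont_x y)+
  have "\<bar>\<psi> (\<lambda>t. (1 - x t * x t) * y t)\<bar> \<le> 1 * \<psi> (\<lambda>t. (1 - x t * x t) * x t)"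
    using x1 by (intro dominated_by_weight continuous_intros cont_x y) auto
  also have "\<psi> (\<lambda>t. (1 - x t * x t) * x t) = 1 - \<psi> (\<lambda>t. x t * x t * x t)"
    using sub[OF cont_x c(1)] attains by (simp add: left_diff_distrib)
  also have "\<psi> (\<lambda>t. (1 - x t * x t) * y t) = \<psi> y - \<psi> (\<lambda>t. x t * y t * x t)"
    using sub[OF y(1) c(2)] by (simp add: algebra_simps)
  finally show ?thesis using cube_ge by simp
qed

text \<open>A Markov inequality for the positive functional \<open>f \<mapsto> \<psi> (f x)\<close>
  of mass one, applied to the nonnegative function \<open>1 - x y\<close>, whose integral is at most
  \<delta>.\<close>

lemma localising_weight:
  assumes y: "continuous_on UNIV y" "\<And>t. \<bar>y t\<bar> \<le> 1"
    and \<delta>: "1 - \<delta> \<le> \<psi> y" and \<kappa>: "0 < \<kappa>"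
  obtains w where "continuous_on UNIV w" "\<And>t. 0 \<le> w t" "\<And>t. w t \<le> 1"
    "\<And>t. w t \<noteq> 0 \<Longrightarrow> 1 - \<kappa> < x t * y t" "1 - \<delta> / \<kappa> \<le> \<psi> (\<lambda>t. w t * x t)"
proof
  define w where "w t = max 0 (1 - (1 - x t * y t) / \<kappa>)" for t
  show contw: "continuous_on UNIV w"
    unfolding w_def using \<kappa> by (intro continuous_intros cont_x y) auto
  have xy: "x t * y t \<le> 1" for t
  proof -
    have "\<bar>x t\<bar> * \<bar>y t\<bar> \<le> 1 * 1" using abs_x y(2) by (intro mult_mono) auto
    then show ?thesis by (simp add: abs_mult[symmetric])
  qed
  show "0 \<le> w t" for t by (simp add: w_def)
  show "w t \<le> 1" for t using xy[of t] \<kappa> by (simp add: w_def)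
  show "1 - \<kappa> < x t * y t" if "w t \<noteq> 0" for t
  proof -
    have "0 < 1 - (1 - x t * y t) / \<kappa>" using that unfolding w_def by linarith
    then show ?thesis using \<kappa> by (simp add: field_simps)
  qed
  \<comment> \<open>The amount by which clipping at 0 raises \<open>w\<close> above the affine
    expression; being nonnegative, it can only increase \<open>\<psi> (w x)\<close>.\<close>
  define u where "u t = w t - (1 - (1 - x t * y t) / \<kappa>)" for t
  have contu: "continuous_on UNIV u"
    unfolding u_def using \<kappa> by (intro continuous_intros contw cont_x y) auto
  have c: "continuous_on UNIV (\<lambda>t. (1 - 1 / \<kappa>) * x t)" "continuous_on UNIV (\<lambda>t. (1 / \<kappa>) * ((x t * y t) * x t))"
    "continuous_on UNIV (\<lambda>t. u t * x t)" "continuous_on UNIV (\<lambda>t. (x t * y t) * x t)"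
    by (intro continuous_intros cont_x y contu)+
  have "0 \<le> \<psi> (\<lambda>t. u t * x t)"
    by (rule weight_nonneg[OF contu]) (simp add: u_def w_def)
  moreover have "\<psi> (\<lambda>t. w t * x t) = \<psi> (\<lambda>t. u t * x t + ((1 - 1 / \<kappa>) * x t + (1 / \<kappa>) * ((x t * y t) * x t)))"
    by (rule arg_cong[of _ _ \<psi>]) (auto simp: u_def algebra_simps diff_divide_distrib)
  then have "\<psi> (\<lambda>t. w t * x t) = \<psi> (\<lambda>t. u t * x t) + ((1 - 1 / \<kappa>) + (1 / \<kappa>) * \<psi> (\<lambda>t. (x t * y t) * x t))"
    by (simp only: add[OF c(3) continuous_on_add[OF c(1,2)]] add[OF c(1,2)] scale[OF cont_x]
        scale[OF c(4)] attains mult_1_right)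
  moreover have "(1 / \<kappa>) * (1 - \<delta>) \<le> (1 / \<kappa>) * \<psi> (\<lambda>t. (x t * y t) * x t)"
    using functional_le_weight[OF y] \<delta> \<kappa> by (intro mult_left_mono) auto
  ultimately show "1 - \<delta> / \<kappa> \<le> \<psi> (\<lambda>t. w t * x t)"
    by (simp add: right_diff_distrib)
qed

text \<open>With \<open>a\<close> the retained mass, \<open>\<psi> f - \<psi>0 f\<close> is
  \<open>\<psi> ((1 - w) f)\<close> minus \<open>(1 - a) \<psi>0 f\<close>: the discarded mass and
  the renormalisation each cost \<open>(1 - a) b\<close>.\<close>

lemma localised_functional:
  assumes w: "continuous_on UNIV w" "\<And>t. 0 \<le> w t" "\<And>t. w t \<le> 1"
    and a: "0 < \<psi> (\<lambda>t. w t * x t)"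
  defines "\<psi>0 \<equiv> \<lambda>f. \<psi> (\<lambda>t. w t * f t) / \<psi> (\<lambda>t. w t * x t)"
  shows "contractive_functional \<psi>0"
    and "\<lbrakk>continuous_on UNIV f; \<And>t. \<bar>f t\<bar> \<le> b\<rbrakk> \<Longrightarrow> \<bar>\<psi> f - \<psi>0 f\<bar> \<le> 2 * (1 - \<psi> (\<lambda>t. w t * x t)) * b"
proof -
  let ?a = "\<psi> (\<lambda>t. w t * x t)"
  have cw: "continuous_on UNIV (\<lambda>t. w t * f t)" if "continuous_on UNIV f" for f
    by (intro continuous_intros w that)
  have bd: "\<bar>\<psi>0 f\<bar> \<le> b" if f: "continuous_on UNIV f" "\<And>t. \<bar>f t\<bar> \<le> b" for f b
    using dominated_by_weight[OF w f] a by (simp add: \<psi>0_def field_simps)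
  show "contractive_functional \<psi>0"
  proof
    fix f g :: "'k \<Rightarrow> real" assume f: "continuous_on UNIV f" and g: "continuous_on UNIV g"
    show "\<psi>0 (\<lambda>x. f x + g x) = \<psi>0 f + \<psi>0 g"
      using add[OF cw[OF f] cw[OF g]] by (simp add: \<psi>0_def distrib_left add_divide_distrib)
  next
    fix f :: "'k \<Rightarrow> real" and c assume f: "continuous_on UNIV f"
    show "\<psi>0 (\<lambda>x. c * f x) = c * \<psi>0 f"
      using scale[OF cw[OF f], of c] by (simp add: \<psi>0_def mult.left_commute)
  qed (auto intro: compact bd)
  assume f: "continuous_on UNIV f" "\<And>t. \<bar>f t\<bar> \<le> b"
  have "\<bar>\<psi> (\<lambda>t. (1 - w t) * f t)\<bar> \<le> b * \<psi> (\<lambda>t. (1 - w t) * x t)"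
    using w by (intro dominated_by_weight continuous_intros f) auto
  also have "\<psi> (\<lambda>t. (1 - w t) * x t) = 1 - ?a"
    using sub[OF cont_x cw[OF cont_x]] attains by (simp add: left_diff_distrib)
  also have "\<psi> (\<lambda>t. (1 - w t) * f t) = \<psi> f - ?a * \<psi>0 f"
    using sub[OF f(1) cw[OF f(1)]] a by (simp add: \<psi>0_def left_diff_distrib)
  finally have 1: "\<bar>\<psi> f - ?a * \<psi>0 f\<bar> \<le> b * (1 - ?a)" .
  have a1: "?a \<le> 1"
  proof -
    have "\<bar>\<psi> (\<lambda>t. w t * x t)\<bar> \<le> 1"
      using w(2,3) abs_x by (intro bound cw cont_x) (simp add: abs_mult mult_le_one)
    then show ?thesis by simp
  qed
  have "\<bar>(1 - ?a) * \<psi>0 f\<bar> \<le> (1 - ?a) * b"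
    using a1 bd[OF f] by (simp add: abs_mult mult_left_mono)
  moreover have "\<psi> f - \<psi>0 f = (\<psi> f - ?a * \<psi>0 f) - (1 - ?a) * \<psi>0 f" by (simp add: algebra_simps)
  ultimately have "\<bar>\<psi> f - \<psi>0 f\<bar> \<le> b * (1 - ?a) + (1 - ?a) * b"
    using 1 by linarith
  then show "\<bar>\<psi> f - \<psi>0 f\<bar> \<le> 2 * (1 - ?a) * b" by (simp add: algebra_simps)
qed

end

section \<open>Simultaneous perturbation of a contraction and a state\<close>

lemma bpb_contractive_operator:
  fixes T :: "('k::t2_space \<Rightarrow> real) \<Rightarrow> 'k \<Rightarrow> real"
  assumes lc: "admits_local_compensation TYPE('k)" and T: "contractive_operator T"
    and \<psi>: "attaining_functional \<psi> x"
    and \<epsilon>: "0 < \<epsilon>" "\<epsilon> < 1" and large: "1 - \<epsilon> ^ 3 / 48 \<le> \<psi> (T x)"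
  obtains S \<psi>0 x0 where "contractive_operator S" "attaining_functional \<psi>0 x0" "\<psi>0 (S x0) = 1"
    "\<And>f b t. \<lbrakk>continuous_on UNIV f; \<And>x. \<bar>f x\<bar> \<le> b\<rbrakk> \<Longrightarrow> \<bar>T f t - S f t\<bar> \<le> \<epsilon> * b"
    "\<And>f b. \<lbrakk>continuous_on UNIV f; \<And>x. \<bar>f x\<bar> \<le> b\<rbrakk> \<Longrightarrow> \<bar>\<psi> f - \<psi>0 f\<bar> \<le> \<epsilon> * b"
    "\<And>t. \<bar>x t - x0 t\<bar> \<le> \<epsilon>"
proof -
  interpret \<psi>: attaining_functional \<psi> x by (rule \<psi>)
  interpret T: contractive_functional "\<lambda>f. T f t" for t
    by (rule contractive_operatorD(1)[OF T])
  note x = \<psi>.cont_x \<psi>.abs_x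
  \<comment> \<open>The element moves by at most \<open>2 \<eta> = \<epsilon>\<close> and the
    operator by \<open>6 \<beta> = \<epsilon> / 2\<close>. The deficit \<kappa> allowed at
    \<open>x\<close> is the one that leaves \<beta> at \<open>q\<close>; with it the localisation
    loses mass at most \<open>(\<epsilon> ^ 3 / 48) / \<kappa> = \<epsilon> / 2\<close> and moves
    the functional by at most \<epsilon>.\<close>
  define \<eta> where "\<eta> = \<epsilon> / 2"
  define \<beta> where "\<beta> = \<epsilon> / 12"
  define \<kappa> where "\<kappa> = \<beta> * \<eta>"
  have \<eta>: "0 < \<eta>" "\<eta> < 1" and \<beta>: "0 < \<beta>" "\<beta> \<le> 1 / 4" and \<kappa>: "0 < \<kappa>" "\<kappa> \<le> \<eta>"
    using \<epsilon> by (auto simp: \<eta>_def \<beta>_def \<kappa>_def intro: mult_left_le_one_le)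
  define x0 where "x0 t = max (-1) (min 1 (x t / (1 - \<eta>)))" for t
  define q where "q t = (x t - (1 - \<eta>) * x0 t) / \<eta>" for t
  have contx0: "continuous_on UNIV x0" unfolding x0_def using \<eta> by (intro continuous_intros x) auto
  have contq: "continuous_on UNIV q" unfolding q_def using \<eta> by (intro continuous_intros x contx0) auto
  have abs_x0: "\<bar>x0 t\<bar> \<le> 1" for t by (auto simp: x0_def)
  have decomp: "x t = \<eta> * q t + (1 - \<eta>) * x0 t" for t using \<eta> by (simp add: q_def)
  have cases: "(\<bar>x t\<bar> \<le> 1 - \<eta> \<and> q t = 0) \<or> (1 - \<eta> < x t \<and> x0 t = 1 \<and> 0 \<le> q t \<and> q t \<le> 1)
      \<or> (x t < - (1 - \<eta>) \<and> x0 t = -1 \<and> -1 \<le> q t \<and> q t \<le> 0)" for t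
  proof -
    consider "\<bar>x t\<bar> \<le> 1 - \<eta>" | "1 - \<eta> < x t" | "x t < - (1 - \<eta>)" by linarith
    then show ?thesis
    proof cases
      case 1
      then have "-1 \<le> x t / (1 - \<eta>)" "x t / (1 - \<eta>) \<le> 1"
        using \<eta> by (auto simp: field_simps abs_le_iff)
      then have "x0 t = x t / (1 - \<eta>)" by (simp add: x0_def)
      then show ?thesis using 1 \<eta> by (simp add: q_def)
    next
      case 2
      then have "1 \<le> x t / (1 - \<eta>)" using \<eta> by (simp add: field_simps)
      then have "x0 t = 1" by (simp add: x0_def)
      then show ?thesis using 2 \<eta> x(2)[of t] by (simp add: q_def field_simps)
    next
      case 3
      then have "x t / (1 - \<eta>) \<le> -1" using \<eta> by (simp add: field_simps)
      then have "x0 t = -1" by (simp add: x0_def)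
      then show ?thesis using 3 \<eta> x(2)[of t] by (simp add: q_def field_simps)
    qed
  qed
  have abs_q: "\<bar>q t\<bar> \<le> 1" and qx0: "q t * x0 t = \<bar>q t\<bar>" for t using cases[of t] by auto
  obtain S where S: "contractive_operator S"
    and TS: "\<And>f b t. \<lbrakk>continuous_on UNIV f; \<And>x. \<bar>f x\<bar> \<le> b\<rbrakk> \<Longrightarrow> \<bar>T f t - S f t\<bar> \<le> 6 * \<beta> * b"
    and Sx0: "\<And>t. 1 - \<beta> \<le> \<bar>T q t\<bar> \<Longrightarrow> S x0 t = sgn (T q t)"
    using operator_perturbation[OF lc T contq abs_q contx0 abs_x0 qx0 \<beta>] by blast
  have contTx: "continuous_on UNIV (T x)" by (rule contractive_operatorD(2)[OF T x(1)])
  have abs_Tx: "\<bar>T x t\<bar> \<le> 1" for t by (rule T.bound[OF x])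
  obtain w where w: "continuous_on UNIV w" "\<And>t. 0 \<le> w t" "\<And>t. w t \<le> 1"
    and supp: "\<And>t. w t \<noteq> 0 \<Longrightarrow> 1 - \<kappa> < x t * T x t"
    and mass: "1 - (\<epsilon> ^ 3 / 48) / \<kappa> \<le> \<psi> (\<lambda>t. w t * x t)"
    using \<psi>.localising_weight[OF contTx abs_Tx large \<kappa>(1)] by blast
  let ?a = "\<psi> (\<lambda>t. w t * x t)"
  have "(\<epsilon> ^ 3 / 48) / \<kappa> = \<epsilon> / 2"
    using \<epsilon> by (simp add: \<kappa>_def \<beta>_def \<eta>_def power3_eq_cube field_simps)
  then have mass: "1 - \<epsilon> / 2 \<le> ?a" using mass by simp
  then have a: "0 < ?a" using \<epsilon> by linarith
  define \<psi>0 where "\<psi>0 = (\<lambda>f. \<psi> (\<lambda>t. w t * f t) / ?a)"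
  note loc = \<psi>.localised_functional[OF w a]
  \<comment> \<open>\<open>?a\<close> is a convex combination of the values at \<open>w q\<close>
    and \<open>w x0\<close>, neither of which exceeds \<open>?a\<close>; so both equal it.\<close>
  have wx0: "\<psi> (\<lambda>t. w t * x0 t) = ?a"
  proof -
    have c: "continuous_on UNIV (\<lambda>t. w t * q t)" "continuous_on UNIV (\<lambda>t. w t * x0 t)"
      by (intro continuous_intros w contq contx0)+
    have "?a = \<psi> (\<lambda>t. \<eta> * (w t * q t) + (1 - \<eta>) * (w t * x0 t))"
      using decomp by (intro arg_cong[of _ _ \<psi>] ext) (metis distrib_left mult.left_commute)
    also have "\<dots> = \<eta> * \<psi> (\<lambda>t. w t * q t) + (1 - \<eta>) * \<psi> (\<lambda>t. w t * x0 t)"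
      using \<psi>.scale[OF c(1)] \<psi>.scale[OF c(2)]
      by (subst \<psi>.add) (auto intro!: continuous_intros c)
    finally have eq: "?a = \<eta> * \<psi> (\<lambda>t. w t * q t) + (1 - \<eta>) * \<psi> (\<lambda>t. w t * x0 t)" .
    have "\<psi> (\<lambda>t. w t * q t) \<le> ?a" "\<psi> (\<lambda>t. w t * x0 t) \<le> ?a"
      using \<psi>.dominated_by_weight[OF w contq abs_q] \<psi>.dominated_by_weight[OF w contx0 abs_x0] by auto
    moreover from this have "\<eta> * \<psi> (\<lambda>t. w t * q t) \<le> \<eta> * ?a" using \<eta> by simp
    then have "(1 - \<eta>) * ?a \<le> (1 - \<eta>) * \<psi> (\<lambda>t. w t * x0 t)"
      using eq left_diff_distrib[of 1 \<eta> ?a] by linarith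
    then have "?a \<le> \<psi> (\<lambda>t. w t * x0 t)" using \<eta> by simp
    ultimately show ?thesis by simp
  qed
  \<comment> \<open>On the support of \<open>w\<close> the values of \<open>x\<close> and
    \<open>T x\<close> are near 1 in modulus and of equal sign. This sign is \<open>x0 t\<close> as
    well as \<open>sgn (T q t)\<close>, hence \<open>S x0 t\<close>. Thus the localised functional
    cannot tell \<open>S x0\<close> from \<open>x0\<close>.\<close>
  have wS: "w t * S x0 t = w t * x0 t" for t
  proof (cases "w t = 0")
    case False
    have big: "1 - \<kappa> < x t * T x t" by (rule supp[OF False])
    have \<kappa>1: "\<kappa> < 1" using \<kappa> \<eta> by linarith
    have Tx: "T x t = \<eta> * T q t + (1 - \<eta>) * T x0 t"
    proof -
      have "x = (\<lambda>t. \<eta> * q t + (1 - \<eta>) * x0 t)" using decomp by blast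
      then have "T x t = T (\<lambda>t. \<eta> * q t + (1 - \<eta>) * x0 t) t" by simp
      also have "\<dots> = \<eta> * T q t + (1 - \<eta>) * T x0 t"
        using T.scale[OF contq] T.scale[OF contx0]
        by (subst T.add) (auto intro!: continuous_intros contq contx0)
      finally show ?thesis .
    qed
    have Tx0: "\<bar>T x0 t\<bar> \<le> 1" by (rule T.bound[OF contx0 abs_x0])
    \<comment> \<open>Here the convex decomposition is used: \<open>x0\<close> contributes at most
      \<open>1 - \<eta>\<close>, so a deficit below \<open>\<beta> * \<eta>\<close> for
      \<open>x\<close> forces one below \<beta> for \<open>q\<close>.\<close>
    have key: "1 - \<beta> < e * T q t" if "1 - \<kappa> < e * T x t" "\<bar>e\<bar> = 1" for e
    proof -
      have "(1 - \<eta>) * (e * T x0 t) \<le> 1 - \<eta>"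
      proof (rule mult_left_le)
        have "\<bar>e * T x0 t\<bar> \<le> 1" using Tx0 that by (simp add: abs_mult)
        then show "e * T x0 t \<le> 1" by simp
      qed (use \<eta> in simp)
      moreover have "e * T x t = \<eta> * (e * T q t) + (1 - \<eta>) * (e * T x0 t)"
        unfolding Tx by (simp add: algebra_simps)
      ultimately have "\<eta> - \<beta> * \<eta> < \<eta> * (e * T q t)" using that(1) unfolding \<kappa>_def by linarith
      then have "\<eta> * (1 - \<beta>) < \<eta> * (e * T q t)" by (simp add: algebra_simps)
      then show ?thesis using \<eta> by simp
    qed
    have xT: "x t * T x t \<le> \<bar>x t\<bar>" "x t * T x t \<le> \<bar>T x t\<bar>"
    proof -
      have "x t * T x t \<le> \<bar>x t\<bar> * \<bar>T x t\<bar>" by (metis abs_ge_self abs_mult)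
      moreover have "\<bar>x t\<bar> * \<bar>T x t\<bar> \<le> \<bar>x t\<bar>" "\<bar>x t\<bar> * \<bar>T x t\<bar> \<le> \<bar>T x t\<bar>"
        using x(2)[of t] abs_Tx[of t] by (simp_all add: mult_left_le mult_left_le_one_le)
      ultimately show "x t * T x t \<le> \<bar>x t\<bar>" "x t * T x t \<le> \<bar>T x t\<bar>" by linarith+
    qed
    have pos: "0 < x t * T x t" using big \<kappa>1 by linarith
    have big_x: "1 - \<eta> < \<bar>x t\<bar>" using big xT(1) \<kappa>(2) by linarith
    have "S x0 t = x0 t"
    proof (cases "0 < x t")
      case True
      then have "0 < T x t" using pos by (simp add: zero_less_mult_iff)
      then have "1 - \<kappa> < 1 * T x t" using big xT by linarith
      then have "1 - \<beta> < T q t" using key[of 1] by simp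
      moreover have "x0 t = 1"
        using cases[of t] big_x True \<eta> by auto
      ultimately show ?thesis using Sx0[of t] \<beta> by (simp add: sgn_if)
    next
      case False
      then have "T x t < 0" "x t < 0" using pos by (auto simp: zero_less_mult_iff)
      then have "1 - \<kappa> < (-1) * T x t" using big xT by linarith
      then have "1 - \<beta> < - T q t" using key[of "-1"] by simp
      moreover have "x0 t = -1"
        using cases[of t] big_x \<open>x t < 0\<close> \<eta> by auto
      ultimately show ?thesis using Sx0[of t] \<beta> by (simp add: sgn_if)
    qed
    then show ?thesis by simp
  qed simp
  show ?thesis
  proof (rule that[of S \<psi>0 x0])
    show "contractive_operator S" by (rule S)
    show "attaining_functional \<psi>0 x0"
      using loc(1) wx0 a contx0 abs_x0
      by (intro attaining_functional.intro attaining_functional_axioms.intro) (auto simp: \<psi>0_def)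
    show "\<psi>0 (S x0) = 1" using wx0 ext[of "\<lambda>t. w t * S x0 t", OF wS] a by (simp add: \<psi>0_def)
    show "\<bar>T f t - S f t\<bar> \<le> \<epsilon> * b" if f: "continuous_on UNIV f" "\<And>x. \<bar>f x\<bar> \<le> b" for f b t
    proof -
      have b: "0 \<le> b" using f(2)[of undefined] by simp
      have "6 * \<beta> * b \<le> \<epsilon> * b" using b \<epsilon> by (intro mult_right_mono) (auto simp: \<beta>_def)
      then show ?thesis using TS[OF f, of t] by simp
    qed
    show "\<bar>\<psi> f - \<psi>0 f\<bar> \<le> \<epsilon> * b" if f: "continuous_on UNIV f" "\<And>x. \<bar>f x\<bar> \<le> b" for f b
    proof -
      have b: "0 \<le> b" using f(2)[of undefined] by simp
      have "2 * (1 - ?a) * b \<le> \<epsilon> * b" using b mass by (intro mult_right_mono) auto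
      then show ?thesis using loc(2)[OF f] unfolding \<psi>0_def by linarith
    qed
    show "\<bar>x t - x0 t\<bar> \<le> \<epsilon>" for t
    proof -
      have "x t - x0 t = \<eta> * (q t - x0 t)" using decomp[of t] by (simp add: algebra_simps)
      also have "\<bar>\<dots>\<bar> \<le> \<eta> * 2"
        using abs_q[of t] abs_x0[of t] \<eta> by (simp add: abs_mult mult_left_mono)
      finally show ?thesis by (simp add: \<eta>_def)
    qed
  qed
qed


section \<open>Operators on \<open>C(K)\<close>\<close>

lemma apply_Bcontfun:
  fixes f :: "'k::topological_space \<Rightarrow> real"
  assumes "compact (UNIV :: 'k set)" "continuous_on UNIV f"
  shows "apply_bcontfun (Bcontfun f) = f"
proof -
  have "f \<in> bcontfun"
    using assms compact_continuous_image compact_imp_bounded by (auto simp: bcontfun_def)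
  then show ?thesis by (rule Bcontfun_inverse)
qed

lemma abs_apply_le_norm: "\<bar>apply_bcontfun f x\<bar> \<le> norm (f :: 'k::topological_space \<Rightarrow>\<^sub>C real)"
  using norm_bounded[of f x] by simp

lemma norm_bcontfun_le:
  "(\<And>x. \<bar>apply_bcontfun f x\<bar> \<le> b) \<Longrightarrow> norm (f :: 'k::topological_space \<Rightarrow>\<^sub>C real) \<le> b"
  by (rule norm_bound) simp

lemma contractive_functional_of_blinfun:
  fixes x' :: "('k::t2_space \<Rightarrow>\<^sub>C real) \<Rightarrow>\<^sub>L real"
  assumes K: "compact (UNIV :: 'k set)" and x': "norm x' \<le> 1"
  shows "contractive_functional (\<lambda>f. blinfun_apply x' (Bcontfun f))"
proof
  fix f g :: "'k \<Rightarrow> real" assume f: "continuous_on UNIV f" "continuous_on UNIV g"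
  have "Bcontfun (\<lambda>x. f x + g x) = Bcontfun f + Bcontfun g"
    by (rule bcontfun_eqI) (simp add: apply_Bcontfun[OF K] f continuous_intros)
  then show "blinfun_apply x' (Bcontfun (\<lambda>x. f x + g x)) = blinfun_apply x' (Bcontfun f) + blinfun_apply x' (Bcontfun g)"
    by (simp add: blinfun.add_right)
next
  fix f :: "'k \<Rightarrow> real" and a assume f: "continuous_on UNIV f"
  have "Bcontfun (\<lambda>x. a * f x) = a *\<^sub>R Bcontfun f"
    by (rule bcontfun_eqI) (simp add: apply_Bcontfun[OF K] f continuous_intros)
  then show "blinfun_apply x' (Bcontfun (\<lambda>x. a * f x)) = a * blinfun_apply x' (Bcontfun f)"
    by (simp add: blinfun.scaleR_right)
next
  fix f :: "'k \<Rightarrow> real" and b assume f: "continuous_on UNIV f" "\<And>x. \<bar>f x\<bar> \<le> b"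
  have "\<bar>blinfun_apply x' (Bcontfun f)\<bar> \<le> norm x' * norm (Bcontfun f)"
    using norm_blinfun[of x' "Bcontfun f"] by simp
  also have "\<dots> \<le> 1 * b"
    using f x' by (intro mult_mono norm_bcontfun_le) (auto simp: apply_Bcontfun[OF K])
  finally show "\<bar>blinfun_apply x' (Bcontfun f)\<bar> \<le> b" by simp
qed (rule K)

lemma blinfun_of_contractive_functional:
  fixes \<psi> :: "('k::t2_space \<Rightarrow> real) \<Rightarrow> real"
  assumes "contractive_functional \<psi>"
  obtains x' :: "('k \<Rightarrow>\<^sub>C real) \<Rightarrow>\<^sub>L real" where "\<And>f. blinfun_apply x' f = \<psi> (apply_bcontfun f)" "norm x' \<le> 1"
proof
  interpret \<psi>: contractive_functional \<psi> by (rule assms)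
  let ?x' = "Blinfun (\<lambda>f. \<psi> (apply_bcontfun f)) :: ('k \<Rightarrow>\<^sub>C real) \<Rightarrow>\<^sub>L real"
  have bd: "\<bar>\<psi> (apply_bcontfun f)\<bar> \<le> norm f" for f :: "'k \<Rightarrow>\<^sub>C real"
    by (rule \<psi>.bound) (auto intro: abs_apply_le_norm)
  have "bounded_linear (\<lambda>f :: 'k \<Rightarrow>\<^sub>C real. \<psi> (apply_bcontfun f))"
  proof (rule bounded_linear_intro)
    show "norm (\<psi> (apply_bcontfun f)) \<le> norm f * 1" for f :: "'k \<Rightarrow>\<^sub>C real" using bd by simp
  qed (simp_all add: \<psi>.add \<psi>.scale)
  then show app: "blinfun_apply ?x' f = \<psi> (apply_bcontfun f)" for f
    by (simp add: bounded_linear_Blinfun_apply)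
  show "norm ?x' \<le> 1"
    by (rule norm_blinfun_bound) (use app bd in auto)
qed

lemma point_evaluation_blinfun:
  fixes t :: "'k::t2_space"
  assumes K: "compact (UNIV :: 'k set)"
  obtains e :: "('k \<Rightarrow>\<^sub>C real) \<Rightarrow>\<^sub>L real" where "\<And>f. blinfun_apply e f = apply_bcontfun f t" "norm e \<le> 1"
proof -
  have "contractive_functional (\<lambda>f :: 'k \<Rightarrow> real. f t)" by unfold_locales (auto simp: K)
  then show ?thesis using blinfun_of_contractive_functional that by blast
qed

section \<open>Numerical radius and norm on C(K)\<close>

lemma state_pairI:
  fixes f :: "'k::t2_space \<Rightarrow>\<^sub>C real"
  assumes "norm f \<le> 1" "norm x' \<le> 1" "blinfun_apply x' f = 1"
  shows "(f, x') \<in> state_pairs"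
proof -
  have "1 \<le> norm x' * norm f" using norm_blinfun[of x' f] assms(3) by simp
  moreover have "norm x' * norm f \<le> norm f" "norm x' * norm f \<le> norm x'"
    using assms by (simp_all add: mult_left_le mult_left_le_one_le)
  ultimately show ?thesis using assms by (simp add: state_pairs_def)
qed

lemma state_pair_value_le:
  "(f, x') \<in> state_pairs \<Longrightarrow> \<bar>blinfun_apply x' (blinfun_apply T f)\<bar> \<le> norm T"
proof -
  assume "(f, x') \<in> state_pairs"
  then have n: "norm f = 1" "norm x' = 1" by (auto simp: state_pairs_def)
  have "\<bar>blinfun_apply x' (blinfun_apply T f)\<bar> \<le> norm x' * norm (blinfun_apply T f)"
    using norm_blinfun[of x' "blinfun_apply T f"] by simp
  also have "\<dots> \<le> norm T" using norm_blinfun[of T f] n by simp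
  finally show ?thesis .
qed

lemma state_pair_value_le_radius:
  assumes "(f, x') \<in> state_pairs"
  shows "\<bar>blinfun_apply x' (blinfun_apply T f)\<bar> \<le> numerical_radius T"
  unfolding numerical_radius_def
  using cSUP_upper[OF assms, of "\<lambda>(x, x'). \<bar>blinfun_apply x' (blinfun_apply T x)\<bar>"]
    state_pair_value_le[of _ _ T] by (force intro!: bdd_aboveI2[where M = "norm T"])

lemma state_pairs_nonempty:
  assumes K: "compact (UNIV :: 'k::t2_space set)"
  shows "(state_pairs :: (('k \<Rightarrow>\<^sub>C real) \<times> (('k \<Rightarrow>\<^sub>C real) \<Rightarrow>\<^sub>L real)) set) \<noteq> {}"
proof -
  obtain e :: "('k \<Rightarrow>\<^sub>C real) \<Rightarrow>\<^sub>L real" where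
    e: "\<And>f. blinfun_apply e f = apply_bcontfun f undefined" "norm e \<le> 1"
    using point_evaluation_blinfun[OF K, of undefined] by blast
  have "(const_bcontfun 1, e) \<in> state_pairs"
    by (intro state_pairI norm_bcontfun_le e) (simp_all add: e)
  then show ?thesis by blast
qed

lemma numerical_radius_le_norm:
  assumes "compact (UNIV :: 'k::t2_space set)"
  shows "numerical_radius (T :: ('k \<Rightarrow>\<^sub>C real) \<Rightarrow>\<^sub>L ('k \<Rightarrow>\<^sub>C real)) \<le> norm T"
  unfolding numerical_radius_def
  using state_pairs_nonempty[OF assms] by (intro cSUP_least) (auto intro: state_pair_value_le)

text \<open>A function \<open>f\<close> with \<open>\<bar>f\<bar> \<le> 1\<close> is uniformly close to a convex combination of the functions
  \<open>f + p (1 - f)\<close> and \<open>f - p (1 + f)\<close>, which take the values \<open>1\<close> and \<open>-1\<close> at \<open>t\<close>, if \<open>p\<close> is a bump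
  at \<open>t\<close> of small support.\<close>

lemma norm_le_numerical_radius:
  fixes T :: "('k::t2_space \<Rightarrow>\<^sub>C real) \<Rightarrow>\<^sub>L ('k \<Rightarrow>\<^sub>C real)"
  assumes K: "compact (UNIV :: 'k set)"
  shows "norm T \<le> numerical_radius T"
proof -
  let ?\<nu> = "numerical_radius T"
  define A where "A t f = apply_bcontfun (blinfun_apply T (Bcontfun f)) t" for t f
  have A_add: "A t (\<lambda>x. f x + g x) = A t f + A t g"
    if "continuous_on UNIV f" "continuous_on UNIV g" for t f g
  proof -
    have "Bcontfun (\<lambda>x. f x + g x) = Bcontfun f + Bcontfun g"
      by (rule bcontfun_eqI) (simp add: apply_Bcontfun[OF K] that continuous_intros)
    then show ?thesis by (simp add: A_def blinfun.add_right)
  qed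
  have A_scale: "A t (\<lambda>x. a * f x) = a * A t f" if "continuous_on UNIV f" for t f a
  proof -
    have "Bcontfun (\<lambda>x. a * f x) = a *\<^sub>R Bcontfun f"
      by (rule bcontfun_eqI) (simp add: apply_Bcontfun[OF K] that continuous_intros)
    then show ?thesis by (simp add: A_def blinfun.scaleR_right)
  qed
  have A_bound: "\<bar>A t f\<bar> \<le> norm T * b" if "continuous_on UNIV f" "\<And>x. \<bar>f x\<bar> \<le> b" for t f b
  proof -
    have "\<bar>A t f\<bar> \<le> norm T * norm (Bcontfun f)"
      unfolding A_def by (rule order_trans[OF abs_apply_le_norm norm_blinfun])
    also have "\<dots> \<le> norm T * b"
      using that by (intro mult_left_mono norm_bcontfun_le) (auto simp: apply_Bcontfun[OF K])
    finally show ?thesis .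
  qed
  \<comment> \<open>A function of norm one with value 1 at \<open>t\<close> forms a state together
    with evaluation at \<open>t\<close>.\<close>
  have peak: "\<bar>A t f\<bar> \<le> ?\<nu>" if f: "continuous_on UNIV f" "\<And>x. \<bar>f x\<bar> \<le> 1" "f t = 1" for t f
  proof -
    obtain e :: "('k \<Rightarrow>\<^sub>C real) \<Rightarrow>\<^sub>L real" where
      e: "\<And>f. blinfun_apply e f = apply_bcontfun f t" "norm e \<le> 1"
      using point_evaluation_blinfun[OF K] by blast
    have "(Bcontfun f, e) \<in> state_pairs"
      using f by (intro state_pairI norm_bcontfun_le e) (auto simp: e apply_Bcontfun[OF K])
    from state_pair_value_le_radius[OF this, of T] show ?thesis by (simp add: e A_def)
  qed
  have unit: "\<bar>A t f\<bar> \<le> ?\<nu>" if f: "continuous_on UNIV f" "\<And>x. \<bar>f x\<bar> \<le> 1" for t f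
  proof (rule field_le_epsilon)
    fix \<epsilon> :: real assume \<epsilon>: "0 < \<epsilon>"
    \<comment> \<open>The oscillation of \<open>f\<close> tolerated on the bump, small enough that
      \<open>T\<close> turns it into at most \<epsilon>.\<close>
    define d where "d = \<epsilon> / (norm T + 1)"
    have "0 < norm T + 1" using norm_ge_zero[of T] by linarith
    then have d: "0 < d" "norm T * d \<le> \<epsilon>" using \<epsilon> by (auto simp: d_def field_simps)
    have closed: "closed {x. d \<le> \<bar>f x - f t\<bar>}"
      by (intro closed_real_levels continuous_intros f)
    obtain p :: "'k \<Rightarrow> real" where p: "continuous_on UNIV p" "\<And>x. 0 \<le> p x" "\<And>x. p x \<le> 1"
      "\<And>x. x \<in> {x. d \<le> \<bar>f x - f t\<bar>} \<Longrightarrow> p x = 0" "\<And>x. x \<in> {t} \<Longrightarrow> p x = 1"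
      using compact_t2_Urysohn[OF K closed, of "{t}"] d(1) by auto
    define f1 where "f1 x = f x + p x * (1 - f x)" for x
    \<comment> \<open>The negative of the function that takes the value -1 at \<open>t\<close>, so
      that \<open>peak\<close> applies to it; this is why its coefficient below is
      \<open>l - 1\<close>.\<close>
    define f2 where "f2 x = p x * (1 + f x) - f x" for x
    have c: "continuous_on UNIV f1" "continuous_on UNIV f2" "continuous_on UNIV (\<lambda>x. p x * (f x - f t))"
      unfolding f1_def f2_def by (intro continuous_intros f p)+
    have fx: "-1 \<le> f x" "f x \<le> 1" for x using f(2)[of x] by auto
    have "\<bar>f1 x\<bar> \<le> 1" for x
    proof -
      have "0 \<le> p x * (1 - f x)" "p x * (1 - f x) \<le> 1 - f x"
        using p(2,3)[of x] fx[of x] by (auto intro: mult_left_le_one_le)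
      then show ?thesis using fx[of x] by (simp add: f1_def abs_le_iff)
    qed
    then have 1: "\<bar>A t f1\<bar> \<le> ?\<nu>" using p(5)[of t] by (intro peak c) (auto simp: f1_def)
    have "\<bar>f2 x\<bar> \<le> 1" for x
    proof -
      have "0 \<le> p x * (1 + f x)" "p x * (1 + f x) \<le> 1 + f x"
        using p(2,3)[of x] fx[of x] by (auto intro: mult_left_le_one_le)
      then show ?thesis using fx[of x] by (simp add: f2_def abs_le_iff)
    qed
    then have 2: "\<bar>A t f2\<bar> \<le> ?\<nu>" using p(5)[of t] by (intro peak c) (auto simp: f2_def)
    have "\<bar>p x * (f x - f t)\<bar> \<le> d" for x
    proof (cases "d \<le> \<bar>f x - f t\<bar>")
      case True
      then have "p x = 0" using p(4)[of x] by simp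
      then show ?thesis using d by simp
    next
      case False
      then have "\<bar>p x\<bar> * \<bar>f x - f t\<bar> \<le> 1 * d" using p(2,3)[of x] by (intro mult_mono) auto
      then show ?thesis by (simp add: abs_mult)
    qed
    then have 3: "\<bar>A t (\<lambda>x. p x * (f x - f t))\<bar> \<le> \<epsilon>"
      using A_bound[OF c(3), of d t] d(2) by simp
    \<comment> \<open>With this coefficient the convex combination has the value
      \<open>2 l - 1 = f t\<close> at \<open>t\<close>, and its error is \<open>p (f - f t)\<close>,
      small because \<open>p\<close> vanishes where \<open>f\<close> is far from
      \<open>f t\<close>.\<close>
    define l where "l = (1 + f t) / 2"
    have l: "0 \<le> l" "l \<le> 1" using fx[of t] by (auto simp: l_def)
    have "f = (\<lambda>x. (l * f1 x + (l - 1) * f2 x) + p x * (f x - f t))"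
    proof
      fix x
      have ft: "f t = 2 * l - 1" by (simp add: l_def field_simps)
      show "f x = (l * f1 x + (l - 1) * f2 x) + p x * (f x - f t)"
        unfolding f1_def f2_def ft by (simp add: algebra_simps)
    qed
    then have "A t f = A t (\<lambda>x. (l * f1 x + (l - 1) * f2 x) + p x * (f x - f t))" by simp
    also have "\<dots> = (l * A t f1 + (l - 1) * A t f2) + A t (\<lambda>x. p x * (f x - f t))"
      using A_scale[OF c(1), of t l] A_scale[OF c(2), of t "l - 1"] c
      by (subst A_add; (subst A_add)?) (auto intro!: continuous_intros f p)
    finally have "A t f = l * A t f1 + (l - 1) * A t f2 + A t (\<lambda>x. p x * (f x - f t))" .
    moreover have "\<bar>l * A t f1\<bar> \<le> l * ?\<nu>" "\<bar>(l - 1) * A t f2\<bar> \<le> (1 - l) * ?\<nu>"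
      using l 1 2 by (simp_all add: abs_mult mult_left_mono)
    moreover have "l * ?\<nu> + (1 - l) * ?\<nu> = ?\<nu>" by (simp add: algebra_simps)
    ultimately show "\<bar>A t f\<bar> \<le> ?\<nu> + \<epsilon>" using 3 by linarith
  qed
  have "norm (blinfun_apply T f) \<le> ?\<nu> * norm f" for f
  proof (cases "f = 0")
    case False
    define g where "g x = (1 / norm f) * apply_bcontfun f x" for x
    have g: "continuous_on UNIV g" unfolding g_def by (intro continuous_intros) auto
    have "\<bar>g x\<bar> \<le> 1" for x
      using False abs_apply_le_norm[of f x] by (simp add: g_def abs_mult)
    then have Ag: "\<bar>A t g\<bar> \<le> ?\<nu>" for t by (intro unit g)
    have gen: "A t g = (1 / norm f) * apply_bcontfun (blinfun_apply T f) t" for t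
    proof -
      have "A t g = (1 / norm f) * A t (apply_bcontfun f)" unfolding g_def by (rule A_scale) auto
      then show ?thesis by (simp add: A_def apply_bcontfun_inverse)
    qed
    have "\<bar>apply_bcontfun (blinfun_apply T f) t\<bar> \<le> ?\<nu> * norm f" for t
    proof -
      have "apply_bcontfun (blinfun_apply T f) t = norm f * A t g" using gen[of t] False by simp
      then show ?thesis using Ag[of t] by (simp add: abs_mult mult_left_mono mult.commute[of "numerical_radius T"])
    qed
    then show ?thesis by (rule norm_bcontfun_le)
  qed simp
  moreover have "0 \<le> ?\<nu>"
    using unit[of "\<lambda>_. 0" undefined] by (simp add: order_trans[OF abs_ge_zero])
  ultimately show ?thesis by (intro norm_blinfun_bound) auto
qed

section \<open>Transfer between contractions on functions and on C(K), and the conclusion\<close>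

lemma contractive_operator_of_blinfun:
  fixes T :: "('k::t2_space \<Rightarrow>\<^sub>C real) \<Rightarrow>\<^sub>L ('k \<Rightarrow>\<^sub>C real)"
  assumes K: "compact (UNIV :: 'k set)" and T: "norm T \<le> 1"
  shows "contractive_operator (\<lambda>f. apply_bcontfun (blinfun_apply T (Bcontfun f)))"
  unfolding contractive_operator_def
proof (intro conjI allI impI)
  fix t
  obtain e :: "('k \<Rightarrow>\<^sub>C real) \<Rightarrow>\<^sub>L real" where
    e: "\<And>f. blinfun_apply e f = apply_bcontfun f t" "norm e \<le> 1"
    using point_evaluation_blinfun[OF K] by blast
  have "norm (e o\<^sub>L T) \<le> norm e * norm T" by (rule norm_blinfun_compose)
  also have "\<dots> \<le> 1" using e(2) T by (simp add: mult_le_one)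
  finally show "contractive_functional (\<lambda>f. apply_bcontfun (blinfun_apply T (Bcontfun f)) t)"
    using contractive_functional_of_blinfun[OF K, of "e o\<^sub>L T"] by (simp add: e)
qed auto

lemma blinfun_of_contractive_operator:
  fixes S :: "('k::t2_space \<Rightarrow> real) \<Rightarrow> 'k \<Rightarrow> real"
  assumes S: "contractive_operator S"
  obtains T :: "('k \<Rightarrow>\<^sub>C real) \<Rightarrow>\<^sub>L ('k \<Rightarrow>\<^sub>C real)" where
    "\<And>f. apply_bcontfun (blinfun_apply T f) = S (apply_bcontfun f)" "norm T \<le> 1"
proof
  interpret S: contractive_functional "\<lambda>f. S f t" for t
    by (rule contractive_operatorD(1)[OF S])
  let ?F = "\<lambda>f :: 'k \<Rightarrow>\<^sub>C real. Bcontfun (S (apply_bcontfun f))"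
  have app: "apply_bcontfun (?F f) = S (apply_bcontfun f)" for f
    by (intro apply_Bcontfun S.compact contractive_operatorD(2)[OF S]) auto
  have bd: "norm (?F f) \<le> norm f" for f
    by (rule norm_bcontfun_le) (auto simp: app intro!: S.bound abs_apply_le_norm)
  have bl: "bounded_linear ?F"
  proof (rule bounded_linear_intro)
    show "?F (f + g) = ?F f + ?F g" for f g
      using app[of "f + g"] by (intro bcontfun_eqI) (simp add: app S.add)
    show "?F (r *\<^sub>R f) = r *\<^sub>R ?F f" for r f
      using app[of "r *\<^sub>R f"] by (intro bcontfun_eqI) (simp add: app S.scale)
    show "norm (?F f) \<le> norm f * 1" for f using bd by simp
  qed
  then show "apply_bcontfun (blinfun_apply (Blinfun ?F) f) = S (apply_bcontfun f)" for f
    by (simp add: bounded_linear_Blinfun_apply app)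
  show "norm (Blinfun ?F) \<le> 1"
    by (rule norm_blinfun_bound) (use bd in \<open>auto simp: bounded_linear_Blinfun_apply[OF bl]\<close>)
qed

theorem theorem2p2:
  assumes "compact (UNIV :: 'k::t2_space set)"
    and "admits_local_compensation TYPE('k)"
  shows "BPB_numerical_radius TYPE('k \<Rightarrow>\<^sub>C real)"
  unfolding BPB_numerical_radius_def
proof (intro exI[of _ "\<lambda>\<epsilon>. \<epsilon> ^ 3 / 48"] conjI ballI allI, goal_cases)
  case (1 \<epsilon>)
  then have "\<epsilon> ^ 3 \<le> 1" by (simp add: power_le_one)
  with 1 show ?case by simp
next
  case (2 \<epsilon> T p)
  note K = assms(1)
  obtain x x' where p: "p = (x, x')" by (cases p)
  have state: "(x, x') \<in> state_pairs" using 2(2) p by simp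
  then have n: "norm x = 1" "norm x' = 1" "blinfun_apply x' x = 1" by (auto simp: state_pairs_def)
  have "\<exists>T\<^sub>0. \<exists>(x\<^sub>0, x\<^sub>0')\<in>state_pairs. numerical_radius T\<^sub>0 = 1 \<and>
      blinfun_apply x\<^sub>0' (blinfun_apply T\<^sub>0 x\<^sub>0) = 1 \<and> numerical_radius (T - T\<^sub>0) \<le> \<epsilon> \<and>
      norm (x - x\<^sub>0) \<le> \<epsilon> \<and> norm (x' - x\<^sub>0') \<le> \<epsilon>"
    if T: "numerical_radius T = 1" and large: "1 - \<epsilon> ^ 3 / 48 \<le> blinfun_apply x' (blinfun_apply T x)"
  proof -
    have \<epsilon>: "0 < \<epsilon>" "\<epsilon> < 1" using 2(1) by auto
    define \<psi> where "\<psi> f = blinfun_apply x' (Bcontfun f)" for f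
    define A where "A f = apply_bcontfun (blinfun_apply T (Bcontfun f))" for f
    have normT: "norm T \<le> 1" using norm_le_numerical_radius[OF K, of T] T by simp
    have A: "contractive_operator A"
      unfolding A_def by (rule contractive_operator_of_blinfun[OF K normT])
    have \<psi>: "attaining_functional \<psi> (apply_bcontfun x)"
      unfolding \<psi>_def using n abs_apply_le_norm[of x]
      by (intro attaining_functional.intro attaining_functional_axioms.intro
          contractive_functional_of_blinfun K) (auto simp: apply_bcontfun_inverse)
    have "1 - \<epsilon> ^ 3 / 48 \<le> \<psi> (A (apply_bcontfun x))"
      using large by (simp add: \<psi>_def A_def apply_bcontfun_inverse)
    then obtain S \<psi>0 x0 where S: "contractive_operator S" and \<psi>0: "attaining_functional \<psi>0 x0"
      and att: "\<psi>0 (S x0) = 1"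
      and AS: "\<And>f b t. \<lbrakk>continuous_on UNIV f; \<And>x. \<bar>f x\<bar> \<le> b\<rbrakk> \<Longrightarrow> \<bar>A f t - S f t\<bar> \<le> \<epsilon> * b"
      and \<psi>\<psi>0: "\<And>f b. \<lbrakk>continuous_on UNIV f; \<And>x. \<bar>f x\<bar> \<le> b\<rbrakk> \<Longrightarrow> \<bar>\<psi> f - \<psi>0 f\<bar> \<le> \<epsilon> * b"
      and xx0: "\<And>t. \<bar>apply_bcontfun x t - x0 t\<bar> \<le> \<epsilon>"
      using bpb_contractive_operator[OF assms(2) A \<psi> \<epsilon>] by blast
    interpret \<psi>0: attaining_functional \<psi>0 x0 by (rule \<psi>0)
    obtain T0 :: "('k \<Rightarrow>\<^sub>C real) \<Rightarrow>\<^sub>L ('k \<Rightarrow>\<^sub>C real)" where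
      T0: "\<And>f. apply_bcontfun (blinfun_apply T0 f) = S (apply_bcontfun f)" "norm T0 \<le> 1"
      using blinfun_of_contractive_operator[OF S] by blast
    obtain x0' :: "('k \<Rightarrow>\<^sub>C real) \<Rightarrow>\<^sub>L real" where
      x0': "\<And>f. blinfun_apply x0' f = \<psi>0 (apply_bcontfun f)" "norm x0' \<le> 1"
      using blinfun_of_contractive_functional[OF \<psi>0.contractive_functional_axioms] by blast
    let ?x0 = "Bcontfun x0"
    have x0: "apply_bcontfun ?x0 = x0" by (rule apply_Bcontfun[OF K \<psi>0.cont_x])
    have state0: "(?x0, x0') \<in> state_pairs"
      using \<psi>0.abs_x by (intro state_pairI norm_bcontfun_le x0') (auto simp: x0 x0' \<psi>0.attains)
    have attained: "blinfun_apply x0' (blinfun_apply T0 ?x0) = 1"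
      by (simp add: x0' T0 x0 att)
    \<comment> \<open>The norm bounds the radius above by 1, and the value at the new state bounds
      it below by 1.\<close>
    have "numerical_radius T0 = 1"
      using numerical_radius_le_norm[OF K, of T0] T0(2) state_pair_value_le_radius[OF state0, of T0] attained
      by simp
    moreover have "norm (T - T0) \<le> \<epsilon>"
    proof (rule norm_blinfun_bound)
      fix f :: "'k \<Rightarrow>\<^sub>C real"
      have "\<bar>A (apply_bcontfun f) t - S (apply_bcontfun f) t\<bar> \<le> \<epsilon> * norm f" for t
        by (rule AS) (auto intro: abs_apply_le_norm)
      then show "norm (blinfun_apply (T - T0) f) \<le> \<epsilon> * norm f"
        by (intro norm_bcontfun_le) (simp add: blinfun.diff_left T0 A_def apply_bcontfun_inverse)
    qed (use \<epsilon> in simp)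
    then have "numerical_radius (T - T0) \<le> \<epsilon>"
      using numerical_radius_le_norm[OF K, of "T - T0"] by simp
    moreover have "norm (x - ?x0) \<le> \<epsilon>"
      by (rule norm_bcontfun_le) (simp add: x0 xx0)
    moreover have "norm (x' - x0') \<le> \<epsilon>"
    proof (rule norm_blinfun_bound)
      fix f :: "'k \<Rightarrow>\<^sub>C real"
      have "\<bar>\<psi> (apply_bcontfun f) - \<psi>0 (apply_bcontfun f)\<bar> \<le> \<epsilon> * norm f"
        by (rule \<psi>\<psi>0) (auto intro: abs_apply_le_norm)
      then show "norm (blinfun_apply (x' - x0') f) \<le> \<epsilon> * norm f"
        by (simp add: blinfun.diff_left x0' \<psi>_def apply_bcontfun_inverse)
    qed (use \<epsilon> in simp)
    ultimately show ?thesis using state0 attained by blast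
  qed
  then show ?case unfolding p by simp
qed

end
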